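(* Let $G$ be a finite connected weighted graph and let $p>1$. Denote by $0=\lambda_1<\lambda_2\le\dots\le\lambda_n$ the variational eigenvalues of the graph $p$-Laplacian $\Delta_p$ on $G$. Then for every $k\in\{1,\dots,n\}$, any eigenfunction of $\Delta_p$ associated to the eigenvalue $\lambda_k$ induces at most $k$ weak nodal domains.
   Context: Graph: $G$ is a finite, connected, undirected graph with vertex set $V$, $n=|V|$, edge set $E$, strictly positive vertex weights $\mu(u)>0$ ($u\in V$) and symmetric edge weights $w(uv)=w(vu)$, with $w(uv)>0$ if $uv\in E$ and $w(uv)=0$ if $uv\notin E$. Eigenpairs: put $\Phi_p(x)=|x|^{p-2}x$ (with $\Phi_p(0)=0$) and $(\Delta_p f)(u)=\sum_{v\in V}w(uv)\Phi_p(f(u)-f(v))$ for $f:V\to\mathbb{R}$. A nonzero $f:V\to\mathbb{R}$ is an eigenfunction of $\Delta_p$ with eigenvalue $\lambda$ if $(\Delta_p f)(u)=\lambda\,\mu(u)\Phi_p(f(u))$ for all $u\in V$. Variational eigenvalues: for nonzero $f:V\to\mathbb R$ let $\mathcal{R}_p(f)=\frac12\,\frac{\sum_{u,v\in V}w(uv)|f(u)-f(v)|^p}{\sum_{u\in V}\mu(u)|f(u)|^p}$, and let $\mathcal{S}_p=\{g:V\to\mathbb{R}:\sum_{u}\mu(u)|g(u)|^p=1\}$. For a closed symmetric set $A=-A\subseteq\mathcal{S}_p$ the Krasnoselskii genus $\gamma(A)$ is $0$ if $A=\emptyset$, and otherwise the smallest integer $m$ for which there is a continuous odd map $h:A\to\mathbb{R}^m\setminus\{0\}$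 ($\infty$ if there is none). Let $\mathcal{F}_k(\mathcal{S}_p)=\{A\subseteq\mathcal{S}_p: A=-A,\ A\text{ closed},\ \gamma(A)\ge k\}$. The variational eigenvalues are $\lambda_k=\lambda_k^{(p)}=\min_{A\in\mathcal{F}_k(\mathcal{S}_p)}\max_{f\in A}\mathcal{R}_p(f)$, $k=1,\dots,n$. Weak nodal domains: a subset $A\subseteq V$ is a weak nodal domain induced by $f:V\to\mathbb R$ if the subgraph induced by $A$ is a maximal connected component of (the subgraph induced by) either $\{u:f(u)\ge 0\}$ or $\{u:f(u)\le 0\}$. *)

theory Defs
  imports "HOL-Analysis.Analysis" "Graph_Theory.Graph_Theory"
begin

(* The vertex set is a whole finite type, so n = CARD('v) and functions on V are 'v => real.
   Following Graph_Theory, an undirected graph is a digraph whose arc set is symmetric;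
   loops are not excluded, since they influence none of the notions below. *)
locale weighted_graph = pair_pseudo_graph G
  for G :: "('v::finite) pair_pre_digraph" +
  fixes \<mu> :: "'v \<Rightarrow> real" and w :: "'v \<Rightarrow> 'v \<Rightarrow> real"
  assumes verts_UNIV: "pverts G = UNIV"
    and graph_connected: "Digraph_Component.connected (with_proj G)"
    and vertex_weight_pos: "\<mu> u > 0"
    and edge_weight_sym: "w u v = w v u"
    and edge_weight_pos: "(u, v) \<in> parcs G \<Longrightarrow> w u v > 0"
    and edge_weight_zero: "(u, v) \<notin> parcs G \<Longrightarrow> w u v = 0"

definition Phi :: "real \<Rightarrow> real \<Rightarrow> real" where
  "Phi p x = \<bar>x\<bar> powr (p - 2) * x"

definition p_laplacian ::
    "('v::finite \<Rightarrow> 'v \<Rightarrow> real) \<Rightarrow> real \<Rightarrow> ('v \<Rightarrow> real) \<Rightarrow> 'v \<Rightarrow> real" where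
  "p_laplacian w p f u = (\<Sum>v\<in>UNIV. w u v * Phi p (f u - f v))"

definition eigenfunction ::
    "('v::finite \<Rightarrow> real) \<Rightarrow> ('v \<Rightarrow> 'v \<Rightarrow> real) \<Rightarrow> real \<Rightarrow> real \<Rightarrow> ('v \<Rightarrow> real) \<Rightarrow> bool" where
  "eigenfunction \<mu> w p l f \<longleftrightarrow>
     (\<exists>u. f u \<noteq> 0) \<and> (\<forall>u. p_laplacian w p f u = l * \<mu> u * Phi p (f u))"

definition rayleigh ::
    "('v::finite \<Rightarrow> real) \<Rightarrow> ('v \<Rightarrow> 'v \<Rightarrow> real) \<Rightarrow> real \<Rightarrow> ('v \<Rightarrow> real) \<Rightarrow> real" where
  "rayleigh \<mu> w p f =
     1 / 2 * ((\<Sum>u\<in>UNIV. \<Sum>v\<in>UNIV. w u v * \<bar>f u - f v\<bar> powr p) / (\<Sum>u\<in>UNIV. \<mu> u * \<bar>f u\<bar> powr p))"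

definition p_sphere :: "('v::finite \<Rightarrow> real) \<Rightarrow> real \<Rightarrow> ('v \<Rightarrow> real) set" where
  "p_sphere \<mu> p = {g. (\<Sum>u\<in>UNIV. \<mu> u * \<bar>g u\<bar> powr p) = 1}"

(* A = -A; note that - A on sets is the complement in HOL. *)
definition symmetric_set :: "('v \<Rightarrow> real) set \<Rightarrow> bool" where
  "symmetric_set A \<longleftrightarrow> (\<lambda>g u. - g u) ` A = A"

(* 'v => real carries the product topology, which for finite 'v is the usual topology of R^n.
   Euclidean_space m consists of the sequences vanishing from index m on. The infimum is the
   least element of the set of admissible m, or \<infinity> if that set is empty. *)
definition genus :: "('v::finite \<Rightarrow> real) set \<Rightarrow> enat" where
  "genus A = (if A = {} then 0 else
     Inf {enat m | m. \<exists>h. continuous_map (top_of_set A) (Euclidean_space m) h \<and>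
            (\<forall>g\<in>A. h g \<noteq> (\<lambda>i. 0)) \<and> (\<forall>g\<in>A. h (\<lambda>u. - g u) = (\<lambda>i. - h g i))})"

definition genus_family :: "('v::finite \<Rightarrow> real) \<Rightarrow> real \<Rightarrow> nat \<Rightarrow> ('v \<Rightarrow> real) set set" where
  "genus_family \<mu> p k =
     {A. A \<subseteq> p_sphere \<mu> p \<and> symmetric_set A \<and> closed A \<and> genus A \<ge> enat k}"

(* For 1 \<le> k \<le> n the family is nonempty, each member is nonempty and compact, and both
   extrema are attained, so this is the min-max value. *)
definition variational_eigenvalue ::
    "('v::finite \<Rightarrow> real) \<Rightarrow> ('v \<Rightarrow> 'v \<Rightarrow> real) \<Rightarrow> real \<Rightarrow> nat \<Rightarrow> real" where
  "variational_eigenvalue \<mu> w p k = (INF A \<in> genus_family \<mu> p k. SUP f \<in> A. rayleigh \<mu> w p f)"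

(* In a symmetric digraph strong connectedness is connectedness of the undirected graph, so
   sccs H is the set of connected components of H; all of them are nonempty. *)
definition weak_nodal_domain ::
    "('v::finite) pair_pre_digraph \<Rightarrow> ('v \<Rightarrow> real) \<Rightarrow> 'v set \<Rightarrow> bool" where
  "weak_nodal_domain G f A \<longleftrightarrow>
     with_proj G \<restriction> A \<in> pre_digraph.sccs (with_proj G \<restriction> {u. f u \<ge> 0}) \<or>
     with_proj G \<restriction> A \<in> pre_digraph.sccs (with_proj G \<restriction> {u. f u \<le> 0})"

end

theory Submission
  imports Defs "HOL-Homology.Homology"
begin

text \<open>
  Let \<open>\<lambda>\<close> be the \<open>k\<close>-th variational eigenvalue and suppose that the eigenfunction \<open>f\<close> has
  \<open>k + 1\<close> weak nodal domains \<open>e 0, \<dots>, e k\<close>. Consider the \<open>k\<close>-dimensional space of functions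
  \<open>g = (\<Sum>i<k. x i * f|e i)\<close>, in which the domain \<open>e k\<close> gets the coefficient \<open>0\<close>.

  Every such \<open>g\<close> has energy at most \<open>\<lambda>\<close> times its mass (\<open>energy_comb_le\<close>). Only edges
  between domains of opposite sign matter; there the difference of \<open>g\<close> is a positive combination
  of two coefficients, and convexity of \<open>\<bar>t\<bar> powr p\<close> bounds its power by a sum that, added up over
  all edges, is evaluated by the eigenvalue equation for \<open>f\<close>.

  Equality is rigid. By strict convexity it forces equal coefficients on adjacent domains of
  opposite sign. Domains can also touch only through zeros of \<open>f\<close>; if in addition the Laplacian of
  \<open>g\<close> vanishes at these zeros, then the balance of the positive and negative neighbours of a zero,
  which holds for \<open>f\<close>, forces equal coefficients there too. As the graph is connected, all
  coefficients are then equal to that of \<open>e k\<close>, so \<open>g = 0\<close> (\<open>critical_comb_imp_zero\<close>).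

  Hence, wherever \<open>g \<noteq> 0\<close> attains equality, moving the values at the zeros of \<open>f\<close> a little
  against the Laplacian of \<open>g\<close> lowers the energy strictly and does not lower the mass. By compactness
  of the coefficient sphere one step size serves all \<open>g\<close> (\<open>relaxed_energy_below\<close>). The
  result is an odd continuous image of the \<open>(k - 1)\<close>-sphere in the unit sphere, on which the
  Rayleigh quotient stays strictly below \<open>\<lambda>\<close>. Its genus is at least \<open>k\<close> by the Borsuk-Ulam theorem
  (\<open>genus_of_odd_sphere_image\<close>), which contradicts the definition of \<open>\<lambda>\<close> as a minimum over such
  sets.

  The Borsuk-Ulam theorem is derived from the statement that an odd self-map of the sphere has
  odd Brouwer degree (\<open>odd_map_Brouwer_degree2\<close>). This goes by induction on the dimension: an odd
  map is deformed, among odd maps, into one that preserves the equator, and for such maps the degree has the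
  same parity as that of the restriction to the equator.
\<close>

section \<open>Spheres and normalized maps into them\<close>

lemma topspace_nsphere:
  "topspace (nsphere n) = {x. (\<Sum>i\<le>n. (x i)\<^sup>2) = 1 \<and> (\<forall>i>n. x i = 0)}"
  by (simp add: nsphere)

lemma nsphere_top_of_set: "nsphere n = top_of_set (topspace (nsphere n))"
  by (simp add: nsphere euclidean_product_topology)

lemma continuous_map_nsphere_iff:
  "continuous_map (nsphere m) (nsphere n) f \<longleftrightarrow>
     continuous_on (topspace (nsphere m)) f \<and> f \<in> topspace (nsphere m) \<rightarrow> topspace (nsphere n)"
proof -
  have "continuous_map (top_of_set (topspace (nsphere m))) (top_of_set (topspace (nsphere n))) f \<longleftrightarrow>
     continuous_on (topspace (nsphere m)) f \<and> f \<in> topspace (nsphere m) \<rightarrow> topspace (nsphere n)"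
    unfolding continuous_map_in_subtopology continuous_map_iff_continuous by simp
  then show ?thesis
    by (simp flip: nsphere_top_of_set)
qed

lemma nsphere_abs_le_1:
  assumes "x \<in> topspace (nsphere n)"
  shows "\<bar>x i\<bar> \<le> 1"
proof (cases "i \<le> n")
  case True
  then have "(x i)\<^sup>2 \<le> (\<Sum>i\<le>n. (x i)\<^sup>2)"
    by (intro member_le_sum) auto
  then show ?thesis
    using assms by (simp add: topspace_nsphere abs_square_le_1)
qed (use assms in \<open>auto simp: topspace_nsphere\<close>)

lemma nsphere_uminus:
  "x \<in> topspace (nsphere n) \<Longrightarrow> (\<lambda>i. - x i) \<in> topspace (nsphere n)"
  by (simp add: topspace_nsphere)

lemma compact_nsphere: "compact (topspace (nsphere n))"
proof -
  have "compactin (powertop_real UNIV) (\<Pi>\<^sub>E i\<in>(UNIV::nat set). {-1..1::real})"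
    by (simp add: compactin_PiE)
  then have "compact (\<Pi>\<^sub>E i\<in>(UNIV::nat set). {-1..1::real})"
    by (simp add: euclidean_product_topology flip: compactin_euclidean_iff)
  moreover have "topspace (nsphere n) \<subseteq> (\<Pi>\<^sub>E i\<in>(UNIV::nat set). {-1..1::real})"
    using nsphere_abs_le_1 by (fastforce simp: abs_le_iff)
  moreover have "closed (topspace (nsphere n))"
  proof -
    have eq: "topspace (nsphere n) = {x. (\<Sum>i\<le>n. (x i)\<^sup>2) = 1} \<inter> (\<Inter>i\<in>{n<..}. {x. x i = 0})"
      by (auto simp: topspace_nsphere)
    show ?thesis
      unfolding eq
      by (intro closed_Int closed_INT ballI closed_Collect_eq continuous_intros continuous_on_product_coordinates)
  qed
  ultimately show ?thesis
    by (metis compact_Int_closed inf.absorb_iff2)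
qed

text \<open>
  Radial projection to the sphere; the coordinates beyond \<open>n\<close> are cut off, so that any sequence with a
  nonzero entry among the first \<open>n + 1\<close> is sent to a point of the sphere.
\<close>

definition sphere_normalize :: "nat \<Rightarrow> (nat \<Rightarrow> real) \<Rightarrow> nat \<Rightarrow> real" where
  "sphere_normalize n y = (\<lambda>i. if i \<le> n then y i / sqrt (\<Sum>j\<le>n. (y j)\<^sup>2) else 0)"

lemma sum_squares_pos_iff:
  fixes y :: "nat \<Rightarrow> real"
  shows "0 < (\<Sum>j\<le>n. (y j)\<^sup>2) \<longleftrightarrow> (\<exists>j\<le>n. y j \<noteq> 0)"
proof -
  have "(\<Sum>j\<le>n. (y j)\<^sup>2) = 0 \<longleftrightarrow> (\<forall>j\<le>n. y j = 0)"
    by (subst sum_nonneg_eq_0_iff) auto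
  moreover have "(\<Sum>j\<le>n. (y j)\<^sup>2) \<ge> 0"
    by (rule sum_nonneg) auto
  ultimately show ?thesis
    by (metis less_eq_real_def order_less_irrefl)
qed

lemma sphere_normalize_in_nsphere:
  assumes "\<exists>j\<le>n. y j \<noteq> 0"
  shows "sphere_normalize n y \<in> topspace (nsphere n)"
proof -
  have "(\<Sum>j\<le>n. (y j)\<^sup>2) > 0"
    using assms sum_squares_pos_iff by blast
  then show ?thesis
    by (simp add: topspace_nsphere sphere_normalize_def power_divide flip: sum_divide_distrib)
qed

lemma sphere_normalize_ident:
  "x \<in> topspace (nsphere n) \<Longrightarrow> sphere_normalize n x = x"
  by (auto simp: sphere_normalize_def topspace_nsphere fun_eq_iff)

lemma sphere_normalize_uminus:
  "sphere_normalize n (\<lambda>i. - y i) = (\<lambda>i. - sphere_normalize n y i)"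
  by (auto simp: sphere_normalize_def fun_eq_iff)

lemma continuous_on_sphere_normalize:
  assumes "\<And>i. i \<le> n \<Longrightarrow> continuous_on S (\<lambda>x. F x i)" "\<And>x. x \<in> S \<Longrightarrow> \<exists>j\<le>n. F x j \<noteq> 0"
  shows "continuous_on S (\<lambda>x. sphere_normalize n (F x))"
proof (rule continuous_on_coordinatewise_then_product)
  fix i
  have "sqrt (\<Sum>j\<le>n. (F x j)\<^sup>2) \<noteq> 0" if "x \<in> S" for x
    using assms(2)[OF that] sum_squares_pos_iff[of "F x" n] by auto
  then show "continuous_on S (\<lambda>x. sphere_normalize n (F x) i)"
    unfolding sphere_normalize_def
    by (cases "i \<le> n") (auto intro!: continuous_intros assms(1))
qed

text \<open>
  If the segment from \<open>F x\<close> to \<open>G x\<close> avoids the origin for every \<open>x\<close>, then the normalized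
  segments form a homotopy, so the degree does not notice the change from \<open>F\<close> to \<open>G\<close>.
\<close>

lemma Brouwer_degree2_normalize_homotopic:
  assumes F: "\<And>i. i \<le> n \<Longrightarrow> continuous_on (topspace (nsphere n)) (\<lambda>x. F x i)"
    and G: "\<And>i. i \<le> n \<Longrightarrow> continuous_on (topspace (nsphere n)) (\<lambda>x. G x i)"
    and nz: "\<And>x s. \<lbrakk>x \<in> topspace (nsphere n); 0 \<le> s; s \<le> 1\<rbrakk> \<Longrightarrow> \<exists>i\<le>n. F x i + s * (G x i - F x i) \<noteq> 0"
  shows "Brouwer_degree2 n (\<lambda>x. sphere_normalize n (F x)) = Brouwer_degree2 n (\<lambda>x. sphere_normalize n (G x))"
proof (rule Brouwer_degree2_homotopic)
  define S where "S = topspace (nsphere n)"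
  define h where "h = (\<lambda>(s::real, x). sphere_normalize n (\<lambda>i. F x i + s * (G x i - F x i)))"
  have snd: "continuous_on ({0..1} \<times> S) (\<lambda>z. g (snd z))" if "continuous_on S g" for g :: "_ \<Rightarrow> real"
    by (rule continuous_on_compose2[OF that]) (auto intro: continuous_intros)
  have "continuous_on ({0..1} \<times> S) h"
    unfolding h_def case_prod_unfold
    by (intro continuous_on_sphere_normalize continuous_intros snd)
       (use nz F G in \<open>auto simp: S_def\<close>)
  moreover have "h \<in> ({0..1} \<times> S) \<rightarrow> S"
    unfolding h_def S_def by (auto intro!: sphere_normalize_in_nsphere nz)
  ultimately have "continuous_map (top_of_set ({0..1} \<times> S)) (top_of_set S) h"
    by (simp add: continuous_map_in_subtopology Pi_iff image_subset_iff)
  then have "continuous_map (prod_topology (top_of_set {0..1}) (nsphere n)) (nsphere n) h"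
    unfolding S_def by (metis nsphere_top_of_set prod_topology_subtopology_eu)
  then show "homotopic_with (\<lambda>x. True) (nsphere n) (nsphere n)
     (\<lambda>x. sphere_normalize n (F x)) (\<lambda>x. sphere_normalize n (G x))"
    unfolding homotopic_with_def by (intro exI[of _ h]) (auto simp: h_def)
qed

section \<open>Directions missed by Lipschitz maps of the m-sphere into m + 2 dimensions\<close>

text \<open>
  Otherwise all \<open>m + 1\<close> squares, each at most the absolute value, would be below \<open>1 / (m + 1)\<close>
  and could not add up to \<open>1\<close>.
\<close>

lemma nsphere_large_coordinate:
  assumes "x \<in> topspace (nsphere m)"
  shows "\<exists>i\<le>m. 1 / real (m + 1) \<le> \<bar>x i\<bar>"
proof (rule ccontr)
  assume "\<not> ?thesis"
  then have small: "\<And>i. i \<le> m \<Longrightarrow> \<bar>x i\<bar> < 1 / real (m + 1)"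
    by force
  have "(x i)\<^sup>2 < 1 / real (m + 1)" if "i \<le> m" for i
  proof -
    have "(x i)\<^sup>2 \<le> \<bar>x i\<bar>"
      using nsphere_abs_le_1[OF assms, of i]
      by (metis abs_ge_zero mult_left_le power2_abs power2_eq_square)
    then show ?thesis
      using small[OF that] by linarith
  qed
  then have "(\<Sum>i\<le>m. (x i)\<^sup>2) < (\<Sum>i\<le>m. 1 / real (m + 1))"
    by (intro sum_strict_mono) auto
  then show False
    using assms by (simp add: topspace_nsphere)
qed

text \<open>
  This makes the dimension of the sphere drop by one: near a coordinate bounded away from \<open>0\<close>,
  the sphere is a Lipschitz graph over the remaining coordinates, since \<open>(x i)\<^sup>2 - (y i)\<^sup>2\<close> is
  minus the sum of the other differences of squares and \<open>\<bar>x i + y i\<bar>\<close> is bounded below.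
\<close>

lemma nsphere_coordinate_determined_by_rest:
  assumes x: "x \<in> topspace (nsphere m)" and y: "y \<in> topspace (nsphere m)" and i: "i \<le> m"
    and "1 / real (m + 1) \<le> \<bar>x i\<bar>" "1 / real (m + 1) \<le> \<bar>y i\<bar>" and sgn: "0 < x i \<longleftrightarrow> 0 < y i"
    and e: "0 \<le> e" and close: "\<And>j. j \<in> {..m} - {i} \<Longrightarrow> \<bar>x j - y j\<bar> \<le> e"
  shows "(\<Sum>j\<le>m. \<bar>x j - y j\<bar>) \<le> real (m + 2) ^ 2 * e"
proof -
  have split: "(\<Sum>j\<le>m. g j) = g i + (\<Sum>j\<in>{..m}-{i}. g j)" for g :: "nat \<Rightarrow> real"
    using i by (simp add: sum.remove)
  have rest: "(\<Sum>j\<in>{..m}-{i}. \<bar>x j - y j\<bar>) \<le> real m * e"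
    using sum_bounded_above[of "{..m}-{i}" "\<lambda>j. \<bar>x j - y j\<bar>" e] close i by simp
  have "\<bar>(x i)\<^sup>2 - (y i)\<^sup>2\<bar> = \<bar>\<Sum>j\<in>{..m}-{i}. (y j)\<^sup>2 - (x j)\<^sup>2\<bar>"
  proof -
    have "(x i)\<^sup>2 + (\<Sum>j\<in>{..m}-{i}. (x j)\<^sup>2) = 1" "(y i)\<^sup>2 + (\<Sum>j\<in>{..m}-{i}. (y j)\<^sup>2) = 1"
      using x y split[of "\<lambda>j. (x j)\<^sup>2"] split[of "\<lambda>j. (y j)\<^sup>2"] by (simp_all add: topspace_nsphere)
    then show ?thesis
      unfolding sum_subtractf by linarith
  qed
  also have "\<dots> \<le> (\<Sum>j\<in>{..m}-{i}. \<bar>(y j)\<^sup>2 - (x j)\<^sup>2\<bar>)"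
    by (rule sum_abs)
  also have "\<dots> \<le> (\<Sum>j\<in>{..m}-{i}. 2 * \<bar>x j - y j\<bar>)"
  proof (rule sum_mono)
    fix j
    have "\<bar>(y j)\<^sup>2 - (x j)\<^sup>2\<bar> = \<bar>y j + x j\<bar> * \<bar>x j - y j\<bar>"
      by (simp add: power2_eq_square algebra_simps flip: abs_mult)
    also have "\<dots> \<le> 2 * \<bar>x j - y j\<bar>"
      using nsphere_abs_le_1[OF x, of j] nsphere_abs_le_1[OF y, of j] by (intro mult_right_mono) auto
    finally show "\<bar>(y j)\<^sup>2 - (x j)\<^sup>2\<bar> \<le> 2 * \<bar>x j - y j\<bar>" .
  qed
  also have "\<dots> \<le> 2 * (real m * e)"
    using rest by (simp flip: sum_distrib_left)
  finally have sq: "\<bar>(x i)\<^sup>2 - (y i)\<^sup>2\<bar> \<le> 2 * (real m * e)" .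
  have "2 / real (m + 1) * \<bar>x i - y i\<bar> \<le> \<bar>x i + y i\<bar> * \<bar>x i - y i\<bar>"
    using assms(4,5) sgn by (intro mult_right_mono) (auto simp: abs_if split: if_splits)
  also have "\<dots> = \<bar>(x i)\<^sup>2 - (y i)\<^sup>2\<bar>"
    by (simp add: power2_eq_square algebra_simps flip: abs_mult)
  finally have "2 / real (m + 1) * \<bar>x i - y i\<bar> \<le> 2 * (real m * e)"
    using sq by linarith
  then have "\<bar>x i - y i\<bar> \<le> real (m + 1) * (real m * e)"
    by (simp add: field_simps)
  then have "(\<Sum>j\<le>m. \<bar>x j - y j\<bar>) \<le> real (m + 1) * (real m * e) + real m * e"
    using rest by (simp add: split)
  also have "\<dots> \<le> real (m + 2) ^ 2 * e"
    using e by (simp add: power2_eq_square algebra_simps)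
  finally show ?thesis .
qed

text \<open>
  A pigeonhole form of the fact that the cone over a Lipschitz image of the \<open>m\<close>-sphere has empty interior
  in dimension \<open>m + 2\<close>. The candidates for \<open>q\<close> are the \<open>M ^ (m + 1)\<close> grid points of mesh \<open>1 / M\<close>
  in the hyperplane where the last coordinate is \<open>1\<close>. The sphere is divided into a number of cells of
  order \<open>N ^ m\<close>, small enough that a cell cannot hit two candidates. The cell size only has
  to be a fixed multiple of the mesh, so \<open>N = K * M\<close>, and for large \<open>M\<close> there are fewer cells than
  candidates.
\<close>

lemma Lipschitz_sphere_map_misses_direction:
  assumes lip: "\<And>x y i. \<lbrakk>x \<in> topspace (nsphere m); y \<in> topspace (nsphere m); i \<le> Suc m\<rbrakk>
                  \<Longrightarrow> \<bar>F x i - F y i\<bar> \<le> L * (\<Sum>j\<le>m. \<bar>x j - y j\<bar>)"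
    and nz: "\<And>x. x \<in> topspace (nsphere m) \<Longrightarrow> \<exists>i\<le>Suc m. \<delta> \<le> \<bar>F x i\<bar>" and "0 < \<delta>" and "0 < L"
  obtains q :: "nat \<Rightarrow> real" where "q (Suc m) = 1"
    and "\<And>x. x \<in> topspace (nsphere m) \<Longrightarrow> \<exists>i\<le>Suc m. F x i \<noteq> F x (Suc m) * q i"
proof -
  \<comment> \<open>\<open>K\<close> makes a cell hit at most one candidate, \<open>M\<close> makes the candidates outnumber the cells.\<close>
  define K :: nat where "K = nat \<lceil>2 * L * real (m + 2) ^ 2 / \<delta>\<rceil> + 1"
  define M :: nat where "M = 2 * (m + 1) * (3 * K) ^ m + 1"
  define N where "N = K * M"
  have K: "2 * L * real (m + 2) ^ 2 / \<delta> < real K" "K \<ge> 1"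
    unfolding K_def by linarith+
  have M: "M \<ge> 1"
    by (simp add: M_def)
  have N: "N \<ge> 1"
    using K M by (simp add: N_def)
  define Q where "Q = PiE {..m} (\<lambda>_. {..<M})"
  define q where "q a j = (if j \<le> m then real (a j) / real M else 1)" for a :: "nat \<Rightarrow> nat" and j
  define hit where "hit a x \<longleftrightarrow> x \<in> topspace (nsphere m) \<and> (\<forall>i\<le>Suc m. F x i = F x (Suc m) * q a i)" for a x
  define big where "big x = (SOME i. i \<le> m \<and> 1 / real (m + 1) \<le> \<bar>x i\<bar>)" for x :: "nat \<Rightarrow> real"
  have big: "big x \<le> m \<and> 1 / real (m + 1) \<le> \<bar>x (big x)\<bar>" if "x \<in> topspace (nsphere m)" for x
    unfolding big_def using nsphere_large_coordinate[OF that] by (rule someI_ex)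
  \<comment> \<open>The cell of \<open>x\<close>: a large coordinate, its sign, and the other coordinates rounded to multiples of \<open>1 / N\<close>.\<close>
  define key where "key x = (big x, 0 < x (big x), \<lambda>j\<in>{..m} - {big x}. \<lfloor>real N * x j\<rfloor>)" for x
  define Keys where "Keys = (SIGMA i:{..m}. (UNIV::bool set) \<times> PiE ({..m} - {i}) (\<lambda>_. {- int N..int N}))"
  have finK: "finite Keys"
    unfolding Keys_def by (intro finite_SigmaI finite_cartesian_product finite_PiE) auto
  have cardK: "card Keys \<le> 2 * (m + 1) * (2 * N + 1) ^ m"
  proof -
    have "card Keys = (\<Sum>i\<le>m. 2 * (2 * N + 1) ^ m)"
      unfolding Keys_def
      by (subst card_SigmaI) (auto simp: card_cartesian_product card_PiE finite_PiE nat_add_distrib nat_mult_distrib intro!: sum.cong)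
    then show ?thesis
      by simp
  qed
  have key_mem: "key x \<in> Keys" if x: "x \<in> topspace (nsphere m)" for x
  proof -
    have "\<lfloor>real N * x j\<rfloor> \<in> {- int N..int N}" for j
    proof -
      have "\<bar>real N * x j\<bar> \<le> real N"
        using nsphere_abs_le_1[OF x, of j] by (simp add: abs_mult mult_left_le)
      then show ?thesis
        by (simp add: le_floor_iff floor_le_iff abs_le_iff)
    qed
    then show ?thesis
      using big[OF x] by (auto simp: key_def Keys_def)
  qed
  have key_close: "(\<Sum>j\<le>m. \<bar>x j - y j\<bar>) \<le> real (m + 2) ^ 2 / real N"
    if x: "x \<in> topspace (nsphere m)" and y: "y \<in> topspace (nsphere m)" and eq: "key x = key y" for x y
  proof -
    have b: "big y = big x" and s: "0 < x (big x) \<longleftrightarrow> 0 < y (big x)"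
      using eq by (auto simp: key_def)
    have "\<bar>x j - y j\<bar> \<le> 1 / real N" if j: "j \<in> {..m} - {big x}" for j
    proof -
      have "\<lfloor>real N * x j\<rfloor> = \<lfloor>real N * y j\<rfloor>"
        using eq j unfolding key_def b by (auto dest: fun_cong[of _ _ j])
      then have "\<bar>real N * x j - real N * y j\<bar> \<le> 1"
        by linarith
      then have "real N * \<bar>x j - y j\<bar> \<le> 1"
        by (simp add: abs_mult flip: right_diff_distrib)
      then show ?thesis
        using N by (simp add: field_simps)
    qed
    then show ?thesis
      using nsphere_coordinate_determined_by_rest[OF x y, of "big x" "1 / real N"] big[OF x] big[OF y] b s by simp
  qed
  have inj: "a = b" if a: "a \<in> Q" "hit a x" and b: "b \<in> Q" "hit b y" and eq: "key x = key y" for a b x y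
  proof
    fix j
    show "a j = b j"
    proof (cases "j \<le> m")
      case False
      then show ?thesis
        using a b by (auto simp: Q_def PiE_def extensional_def)
    next
      case True
      define c where "c = F x (Suc m)"
      define d where "d = F y (Suc m)"
      have x: "x \<in> topspace (nsphere m)" and y: "y \<in> topspace (nsphere m)"
        and Fx: "\<And>i. i \<le> Suc m \<Longrightarrow> F x i = c * q a i" and Fy: "\<And>i. i \<le> Suc m \<Longrightarrow> F y i = d * q b i"
        using a(2) b(2) unfolding hit_def c_def d_def by blast+
      have q01: "0 \<le> q a' i" "q a' i \<le> 1" if "a' \<in> Q" for a' i
        using that by (auto simp: q_def Q_def PiE_def Pi_def field_simps intro: less_imp_le)
      obtain i where i: "i \<le> Suc m" "\<delta> \<le> \<bar>F x i\<bar>"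
        using nz[OF x] by blast
      \<comment> \<open>A candidate has entries in \<open>[0, 1]\<close>, so the last entry of \<open>F x\<close> is the largest in absolute value and at least \<open>\<delta>\<close>.\<close>
      have "\<bar>F x i\<bar> = \<bar>c\<bar> * q a i"
        using Fx i q01[OF a(1), of i] by (simp add: abs_mult)
      also have "\<dots> \<le> \<bar>c\<bar>"
        using q01[OF a(1), of i] by (simp add: mult_left_le)
      finally have c: "\<delta> \<le> \<bar>c\<bar>"
        using i by linarith
      define \<eta> where "\<eta> = L * (real (m + 2) ^ 2 / real N)"
      have near: "\<bar>F x i - F y i\<bar> \<le> \<eta>" if "i \<le> Suc m" for i
      proof -
        have "\<bar>F x i - F y i\<bar> \<le> L * (\<Sum>j\<le>m. \<bar>x j - y j\<bar>)"
          using lip x y that by blast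
        also have "\<dots> \<le> \<eta>"
          unfolding \<eta>_def using key_close[OF x y eq] \<open>0 < L\<close> by (intro mult_left_mono) auto
        finally show ?thesis .
      qed
      have "c * (q a j - q b j) = (F x j - F y j) - (c - d) * q b j"
        using Fx[of j] Fy[of j] True by (simp add: algebra_simps)
      then have "\<bar>c\<bar> * \<bar>q a j - q b j\<bar> \<le> \<bar>F x j - F y j\<bar> + \<bar>c - d\<bar> * \<bar>q b j\<bar>"
        by (metis abs_mult abs_triangle_ineq4)
      also have "\<dots> \<le> \<eta> + \<eta> * 1"
        using near[of j] near[of "Suc m"] True q01[OF b(1), of j]
        by (intro add_mono mult_mono) (auto simp: c_def d_def)
      finally have "\<delta> * \<bar>q a j - q b j\<bar> \<le> 2 * \<eta>"
        using mult_right_mono[OF c, of "\<bar>q a j - q b j\<bar>"] by simp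
      then have "\<delta> * \<bar>real (a j) - real (b j)\<bar> / real M \<le> 2 * L * real (m + 2) ^ 2 / (real K * real M)"
        using True by (simp add: q_def \<eta>_def N_def flip: diff_divide_distrib)
      then have "\<delta> * \<bar>real (a j) - real (b j)\<bar> \<le> 2 * L * real (m + 2) ^ 2 / real K"
        using M K by (simp add: field_simps)
      also have "\<dots> < \<delta>"
        using K \<open>0 < \<delta>\<close> by (simp add: field_simps)
      finally show ?thesis
        using \<open>0 < \<delta>\<close> by simp
    qed
  qed
  have "\<exists>a\<in>Q. \<forall>x. \<not> hit a x"
  proof (rule ccontr)
    assume "\<not> ?thesis"
    then obtain X where X: "\<And>a. a \<in> Q \<Longrightarrow> hit a (X a)"
      by metis
    have "inj_on (\<lambda>a. key (X a)) Q"
      using inj X by (meson inj_onI)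
    moreover have "(\<lambda>a. key (X a)) ` Q \<subseteq> Keys"
      using key_mem X by (auto simp: hit_def)
    ultimately have "card Q \<le> card Keys"
      using finK by (metis card_inj_on_le)
    moreover have "card Q = M ^ (m + 1)"
      by (simp add: Q_def card_PiE)
    moreover have "(2 * N + 1) ^ m \<le> (3 * K * M) ^ m"
      using N by (intro power_mono) (auto simp: N_def)
    ultimately have "M ^ (m + 1) \<le> 2 * (m + 1) * (3 * K * M) ^ m"
      using cardK mult_le_mono2[of "(2 * N + 1) ^ m" "(3 * K * M) ^ m" "2 * (m + 1)"] by linarith
    also have "\<dots> = (M - 1) * M ^ m"
    proof -
      have "M - 1 = 2 * (m + 1) * (3 * K) ^ m"
        by (simp add: M_def)
      then show ?thesis
        by (simp only: power_mult_distrib mult.assoc)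
    qed
    finally have "M * M ^ m \<le> (M - 1) * M ^ m"
      by simp
    moreover have "(M - 1) * M ^ m < M * M ^ m"
      using M by (intro mult_strict_right_mono) auto
    ultimately show False
      by linarith
  qed
  then obtain a where "a \<in> Q" "\<And>x. \<not> hit a x"
    by blast
  then show ?thesis
    by (intro that[of "q a"]) (auto simp: q_def hit_def)
qed

section \<open>Odd maps of spheres and the Borsuk-Ulam theorem\<close>

text \<open>
  The Lipschitz functions on the sphere form an algebra that separates points, so they are dense
  by the Stone-Weierstrass theorem; taking the odd part of an approximation makes it odd and
  does not worsen it.
\<close>

lemma odd_sphere_map_Lipschitz_approximation:
  fixes f :: "(nat \<Rightarrow> real) \<Rightarrow> real"
  assumes cont: "continuous_on (topspace (nsphere m)) f"
    and odd: "\<And>x. x \<in> topspace (nsphere m) \<Longrightarrow> f (\<lambda>i. - x i) = - f x" and "0 < e"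
  shows "\<exists>g L. 0 < L \<and> continuous_on (topspace (nsphere m)) g
      \<and> (\<forall>x\<in>topspace (nsphere m). g (\<lambda>i. - x i) = - g x)
      \<and> (\<forall>x\<in>topspace (nsphere m). \<bar>f x - g x\<bar> < e)
      \<and> (\<forall>x\<in>topspace (nsphere m). \<forall>y\<in>topspace (nsphere m). \<bar>g x - g y\<bar> \<le> L * (\<Sum>j\<le>m. \<bar>x j - y j\<bar>))"
proof -
  define S where "S = topspace (nsphere m)"
  define d where "d x y = (\<Sum>j\<le>m. \<bar>x j - y j\<bar>)" for x y :: "nat \<Rightarrow> real"
  have d0: "0 \<le> d x y" for x y
    unfolding d_def by (rule sum_nonneg) auto
  define R where "R = {h. continuous_on S h \<and> (\<exists>L. \<forall>x\<in>S. \<forall>y\<in>S. \<bar>h x - h y\<bar> \<le> L * d x y)}"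
  have S: "compact S" "\<And>x. x \<in> S \<Longrightarrow> (\<lambda>i. - x i) \<in> S"
    using compact_nsphere nsphere_uminus by (auto simp: S_def)
  interpret function_ring_on R S
  proof
    show "compact S"
      by (rule S)
    show "continuous_on S h" if "h \<in> R" for h
      using that by (simp add: R_def)
    show "(\<lambda>_. c) \<in> R" for c
      by (auto simp: R_def intro!: exI[of _ 0])
    show "(\<lambda>x. h x + k x) \<in> R" if h: "h \<in> R" and k: "k \<in> R" for h k
    proof -
      obtain L L' where L: "\<And>x y. x \<in> S \<Longrightarrow> y \<in> S \<Longrightarrow> \<bar>h x - h y\<bar> \<le> L * d x y"
        and L': "\<And>x y. x \<in> S \<Longrightarrow> y \<in> S \<Longrightarrow> \<bar>k x - k y\<bar> \<le> L' * d x y"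
        using h k unfolding R_def by blast
      have "\<bar>(h x + k x) - (h y + k y)\<bar> \<le> (L + L') * d x y" if "x \<in> S" "y \<in> S" for x y
        using L[OF that] L'[OF that] by (simp add: distrib_right)
      then show ?thesis
        using h k by (auto simp: R_def intro!: continuous_intros)
    qed
    show "(\<lambda>x. h x * k x) \<in> R" if h: "h \<in> R" and k: "k \<in> R" for h k
    proof -
      obtain L L' where L: "\<And>x y. x \<in> S \<Longrightarrow> y \<in> S \<Longrightarrow> \<bar>h x - h y\<bar> \<le> L * d x y"
        and L': "\<And>x y. x \<in> S \<Longrightarrow> y \<in> S \<Longrightarrow> \<bar>k x - k y\<bar> \<le> L' * d x y"
        using h k unfolding R_def by blast
      have "bounded (h ` S)" "bounded (k ` S)"
        using h k S by (auto simp: R_def intro: compact_imp_bounded compact_continuous_image)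
      then obtain B C where B: "\<And>x. x \<in> S \<Longrightarrow> \<bar>h x\<bar> \<le> B" and C: "\<And>x. x \<in> S \<Longrightarrow> \<bar>k x\<bar> \<le> C"
        by (auto simp: bounded_iff)
      have "\<bar>h x * k x - h y * k y\<bar> \<le> (B * L' + C * L) * d x y" if xy: "x \<in> S" "y \<in> S" for x y
      proof -
        have "h x * k x - h y * k y = h x * (k x - k y) + k y * (h x - h y)"
          by (simp add: algebra_simps)
        then have "\<bar>h x * k x - h y * k y\<bar> \<le> \<bar>h x\<bar> * \<bar>k x - k y\<bar> + \<bar>k y\<bar> * \<bar>h x - h y\<bar>"
          by (metis abs_mult abs_triangle_ineq)
        also have "\<dots> \<le> B * (L' * d x y) + C * (L * d x y)"
          using B[OF xy(1)] C[OF xy(2)] L[OF xy] L'[OF xy] by (intro add_mono mult_mono) auto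
        finally show ?thesis
          by (simp add: algebra_simps)
      qed
      then show ?thesis
        using h k by (auto simp: R_def intro!: continuous_intros)
    qed
    show "\<exists>h\<in>R. h x \<noteq> h y" if xy: "x \<in> S" "y \<in> S" "x \<noteq> y" for x y
    proof -
      obtain i where i: "x i \<noteq> y i"
        using xy by auto
      have "i \<le> m"
        using i xy by (metis (mono_tags, lifting) S_def linorder_not_le mem_Collect_eq topspace_nsphere)
      then have "\<bar>u i - v i\<bar> \<le> 1 * d u v" for u v
        unfolding d_def using member_le_sum[of i "{..m}" "\<lambda>j. \<bar>u j - v j\<bar>"] by simp
      then have "(\<lambda>x. x i) \<in> R"
        unfolding R_def by (auto intro!: continuous_on_product_coordinates continuous_on_subset[OF continuous_on_product_coordinates] exI[of _ 1])
      then show ?thesis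
        using i by (intro bexI[of _ "\<lambda>x. x i"])
    qed
  qed
  obtain h where h: "h \<in> R" "\<And>x. x \<in> S \<Longrightarrow> \<bar>f x - h x\<bar> < e"
    using Stone_Weierstrass_basic[of f e] cont \<open>0 < e\<close> by (auto simp: S_def)
  obtain L where L: "\<And>x y. x \<in> S \<Longrightarrow> y \<in> S \<Longrightarrow> \<bar>h x - h y\<bar> \<le> L * d x y"
    using h(1) by (auto simp: R_def)
  have conth: "continuous_on S h"
    using h(1) by (simp add: R_def)
  have contneg: "continuous_on S (\<lambda>x i. - x i :: real)"
    by (intro continuous_on_coordinatewise_then_product continuous_intros
        continuous_on_subset[OF continuous_on_product_coordinates]) auto
  \<comment> \<open>The odd part of the approximation.\<close>
  define g where "g x = (h x - h (\<lambda>i. - x i)) / 2" for x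
  have "continuous_on S g"
    unfolding g_def
    by (intro continuous_intros conth continuous_on_compose2[OF conth contneg]) (use S in auto)
  moreover have "g (\<lambda>i. - x i) = - g x" for x
    by (simp add: g_def field_simps)
  moreover have "\<bar>f x - g x\<bar> < e" if "x \<in> S" for x
  proof -
    have "f x - h x < e" "h x - f x < e" "- f x - h (\<lambda>i. - x i) < e" "h (\<lambda>i. - x i) + f x < e"
      using h(2)[OF that] h(2)[OF S(2)[OF that]] odd[OF that[unfolded S_def]] by (simp_all add: abs_less_iff)
    then show ?thesis
      by (simp add: g_def abs_less_iff field_simps)
  qed
  moreover have "\<bar>g x - g y\<bar> \<le> (\<bar>L\<bar> + 1) * d x y" if xy: "x \<in> S" "y \<in> S" for x y
  proof -
    have "d (\<lambda>i. - x i) (\<lambda>i. - y i) = d x y"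
      by (simp add: d_def abs_minus_commute)
    then have "\<bar>g x - g y\<bar> \<le> L * d x y"
      using L[OF xy] L[OF S(2)[OF xy(1)] S(2)[OF xy(2)]] by (simp add: g_def abs_le_iff field_simps)
    also have "\<dots> \<le> (\<bar>L\<bar> + 1) * d x y"
      using d0[of x y] by (intro mult_right_mono) auto
    finally show ?thesis .
  qed
  ultimately show ?thesis
    unfolding S_def d_def by (intro exI[of _ g] exI[of _ "\<bar>L\<bar> + 1"]) auto
qed

text \<open>
  In the induction step \<open>f\<close> is replaced by a Lipschitz odd map \<open>F\<close> whose values on the equator avoid
  a line spanned by some \<open>q\<close> outside the equatorial hyperplane. Projecting along \<open>q\<close> then carries
  the equator into the equatorial hyperplane without meeting the origin. The projection is
  performed fully on the equator only, and not at all where \<open>F x\<close> is a multiple of \<open>q\<close>; the weight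
  \<open>\<beta>\<close> interpolates. As \<open>\<beta>\<close> is even, oddness is kept, and the step from the equator is available.
\<close>

theorem odd_map_Brouwer_degree2:
  assumes "continuous_map (nsphere n) (nsphere n) f"
    and "\<And>x. x \<in> topspace (nsphere n) \<Longrightarrow> f (\<lambda>i. - x i) = (\<lambda>i. - f x i)"
  shows "odd (Brouwer_degree2 n f)"
  using assms
proof (induction n arbitrary: f)
  case 0
  have S: "x \<in> topspace (nsphere 0) \<longleftrightarrow> x = (\<lambda>i. if i = 0 then 1 else 0) \<or> x = (\<lambda>i. - (if i = 0 then 1 else 0))" for x
    by (auto simp: topspace_nsphere power2_eq_1_iff fun_eq_iff)
  let ?e = "(\<lambda>i. if i = 0 then 1 else 0) :: nat \<Rightarrow> real"
  have "?e \<in> topspace (nsphere 0)"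
    by (rule in_topspace_nsphere)
  moreover from this have "f ?e \<in> topspace (nsphere 0)"
    using 0(1) by (auto simp: continuous_map_nsphere_iff)
  ultimately have "f (f x) = x" if "x \<in> topspace (nsphere 0)" for x
    using 0(2)[of ?e] 0(2)[of "\<lambda>i. - ?e i"] that nsphere_uminus[of ?e 0] unfolding S by auto
  then have "homeomorphic_maps (nsphere 0) (nsphere 0) f f"
    using 0(1) by (simp add: homeomorphic_maps_def)
  then have "\<bar>Brouwer_degree2 0 f\<bar> = 1"
    by (rule Brouwer_degree2_homeomorphic_maps)
  then show ?case
    by (metis dvd_abs_iff odd_one)
next
  case (Suc m)
  define n where "n = Suc m"
  define S where "S = topspace (nsphere n)"
  define E where "E = topspace (nsphere m)"
  have E_eq: "E = S \<inter> {x. x n = 0}"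
    unfolding E_def S_def n_def by (metis subtopology_nsphere_equator topspace_subtopology)
  then have ES: "E \<subseteq> S" and E_iff: "\<And>x. x \<in> E \<longleftrightarrow> x \<in> S \<and> x n = 0"
    by auto
  have Sneg: "(\<lambda>i. - x i) \<in> S" if "x \<in> S" for x
    using that by (simp add: S_def nsphere_uminus)
  have f: "continuous_on S f" "\<And>x. x \<in> S \<Longrightarrow> f x \<in> S" and fodd: "\<And>x. x \<in> S \<Longrightarrow> f (\<lambda>i. - x i) = (\<lambda>i. - f x i)"
    using Suc.prems unfolding continuous_map_nsphere_iff by (auto simp: S_def n_def)
  define e where "e = 1 / (2 * real (n + 1))"
  have e: "e > 0" and e2: "1 / real (n + 1) = 2 * e"
    by (simp_all add: e_def field_simps)
  define approx where "approx i g L \<longleftrightarrow> 0 < L \<and> continuous_on S g \<and> (\<forall>x\<in>S. g (\<lambda>i. - x i) = - g x)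
      \<and> (\<forall>x\<in>S. \<bar>f x i - g x\<bar> < e)
      \<and> (\<forall>x\<in>S. \<forall>y\<in>S. \<bar>g x - g y\<bar> \<le> L * (\<Sum>j\<le>n. \<bar>x j - y j\<bar>))" for i :: nat and g L
  have "\<exists>g L. approx i g L" for i
    unfolding approx_def S_def
    by (rule odd_sphere_map_Lipschitz_approximation)
       (use f(1) fodd e in \<open>auto simp: S_def intro: continuous_on_product_then_coordinatewise\<close>)
  then obtain G L where "\<And>i. approx i (G i) (L i)"
    by metis
  then have G: "\<And>i::nat. 0 < L i" "\<And>i. continuous_on S (G i)"
      "\<And>i x. x \<in> S \<Longrightarrow> G i (\<lambda>i. - x i) = - G i x"
      "\<And>i x. x \<in> S \<Longrightarrow> \<bar>f x i - G i x\<bar> < e"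
      "\<And>i x y. x \<in> S \<Longrightarrow> y \<in> S \<Longrightarrow> \<bar>G i x - G i y\<bar> \<le> L i * (\<Sum>j\<le>n. \<bar>x j - y j\<bar>)"
    unfolding approx_def by blast+
  define F where "F x i = G i x" for x i
  \<comment> \<open>The bound for \<open>s = 1\<close> keeps \<open>F\<close> off the origin; for the other \<open>s\<close> it serves the homotopy from \<open>f\<close> to \<open>F\<close>.\<close>
  have F_large: "\<exists>i\<le>n. e \<le> \<bar>f x i + s * (F x i - f x i)\<bar>" if x: "x \<in> S" and s: "0 \<le> s" "s \<le> 1" for x s
  proof -
    obtain i where i: "i \<le> n" "1 / real (n + 1) \<le> \<bar>f x i\<bar>"
      using nsphere_large_coordinate f(2)[OF x] by (auto simp: S_def)
    have "\<bar>s * (F x i - f x i)\<bar> \<le> \<bar>F x i - f x i\<bar>"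
      using s by (simp add: abs_mult mult_left_le_one_le)
    also have "\<dots> < e"
      using G(4)[OF x, of i] by (simp add: F_def abs_minus_commute)
    finally have "e \<le> \<bar>f x i + s * (F x i - f x i)\<bar>"
      using i(2) e2 by linarith
    then show ?thesis
      using i by blast
  qed
  have Fodd: "F (\<lambda>i. - x i) i = - F x i" if "x \<in> S" for x i
    using G(3) that by (simp add: F_def)
  obtain q :: "nat \<Rightarrow> real" where qn: "q n = 1"
    and q: "\<And>x. x \<in> E \<Longrightarrow> \<exists>i\<le>n. F x i \<noteq> F x n * q i"
  proof (rule Lipschitz_sphere_map_misses_direction[of m F "\<Sum>i\<le>n. L i" e])
    fix x y i
    assume x: "x \<in> topspace (nsphere m)" and y: "y \<in> topspace (nsphere m)" and i: "i \<le> Suc m"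
    have "x \<in> S" "y \<in> S" "x n = y n"
      using x y E_iff by (auto simp: E_def)
    then have "\<bar>F x i - F y i\<bar> \<le> L i * (\<Sum>j\<le>m. \<bar>x j - y j\<bar>)"
      using G(5)[of x y i] by (simp add: F_def n_def)
    also have "\<dots> \<le> (\<Sum>i\<le>n. L i) * (\<Sum>j\<le>m. \<bar>x j - y j\<bar>)"
      using i G(1) by (intro mult_right_mono member_le_sum sum_nonneg) (auto simp: n_def intro: less_imp_le)
    finally show "\<bar>F x i - F y i\<bar> \<le> (\<Sum>i\<le>n. L i) * (\<Sum>j\<le>m. \<bar>x j - y j\<bar>)" .
  next
    show "\<exists>i\<le>Suc m. e \<le> \<bar>F x i\<bar>" if "x \<in> topspace (nsphere m)" for x
      using F_large[of x 1] that ES by (auto simp: E_def n_def)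
    show "0 < (\<Sum>i\<le>n. L i)"
      using G(1) by (intro sum_pos) auto
  qed (use e in \<open>auto simp: n_def E_def\<close>)
  \<comment> \<open>\<open>D x\<close> vanishes exactly where \<open>F x\<close> is a multiple of \<open>q\<close>, which does not happen on the equator.\<close>
  define D where "D x = (\<Sum>i\<le>n. \<bar>F x i - F x n * q i\<bar>)" for x
  define \<beta> where "\<beta> x = D x / (D x + \<bar>x n\<bar>)" for x
  define H where "H x i = F x i - \<beta> x * F x n * q i" for x i
  have D0: "0 \<le> D x" for x
    unfolding D_def by (rule sum_nonneg) auto
  have D_eq_0: "D x = 0 \<longleftrightarrow> (\<forall>i\<le>n. F x i = F x n * q i)" for x
    unfolding D_def by (subst sum_nonneg_eq_0_iff) (simp_all add: Ball_def)
  have den: "D x + \<bar>x n\<bar> \<noteq> 0" if "x \<in> S" for x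
  proof
    assume "D x + \<bar>x n\<bar> = 0"
    then have "D x = 0" "x n = 0"
      using D0[of x] by linarith+
    then show False
      using q[of x] that E_iff[of x] D_eq_0[of x] by blast
  qed
  have contF: "continuous_on S (\<lambda>x. F x i)" for i
    using G(2)[of i] by (simp add: F_def[abs_def])
  have cont_coord: "continuous_on S (\<lambda>x. x i)" for i
    by (rule continuous_on_subset[OF continuous_on_product_coordinates]) simp
  have contH: "continuous_on S (\<lambda>x. H x i)" for i
    unfolding H_def \<beta>_def using den unfolding D_def
    by (intro continuous_intros contF cont_coord) auto
  \<comment> \<open>A zero on the way would be a multiple of \<open>q\<close>, but there \<open>\<beta>\<close> is \<open>0\<close> and nothing moves.\<close>
  have segment: "\<exists>i\<le>n. F x i + s * (H x i - F x i) \<noteq> 0" if x: "x \<in> S" and s: "0 \<le> s" "s \<le> 1" for x s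
  proof (rule ccontr)
    assume *: "\<not> (\<exists>i\<le>n. F x i + s * (H x i - F x i) \<noteq> 0)"
    have 0: "F x i = s * \<beta> x * F x n * q i" if "i \<le> n" for i
    proof -
      have "F x i + s * (H x i - F x i) = 0"
        using * that by blast
      then show ?thesis
        unfolding H_def by (simp add: algebra_simps)
    qed
    then have "F x n = s * \<beta> x * F x n"
      using qn by (metis mult.right_neutral order_refl)
    then have "D x = 0"
      using 0 D_eq_0 by metis
    then have "\<And>i. i \<le> n \<Longrightarrow> F x i = 0"
      using 0 by (simp add: \<beta>_def)
    then show False
      using F_large[OF x, of 1] e by auto
  qed
  have Hodd: "H (\<lambda>i. - x i) i = - H x i" if "x \<in> S" for x i
  proof -
    have "D (\<lambda>i. - x i) = D x"
      unfolding D_def using Fodd[OF that] by (intro sum.cong) (auto simp: abs_minus_commute)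
    then show ?thesis
      using Fodd[OF that] by (simp add: H_def \<beta>_def)
  qed
  define h where "h x = sphere_normalize n (H x)" for x
  have Hnz: "\<exists>j\<le>n. H x j \<noteq> 0" if "x \<in> S" for x
    using segment[OF that, of 1] by simp
  have hodd: "h (\<lambda>i. - x i) = (\<lambda>i. - h x i)" if "x \<in> S" for x
  proof -
    have "H (\<lambda>i. - x i) = (\<lambda>i. - H x i)"
      using Hodd[OF that] by (rule ext)
    then show ?thesis
      by (simp add: h_def sphere_normalize_uminus)
  qed
  have conth: "continuous_map (nsphere n) (nsphere n) h"
    unfolding continuous_map_nsphere_iff h_def using Hnz contH
    by (auto simp: S_def intro!: continuous_on_sphere_normalize sphere_normalize_in_nsphere)
  have hE: "h x \<in> E" if "x \<in> E" for x
  proof -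
    have x: "x \<in> S" "x n = 0"
      using that E_iff by auto
    then have "\<beta> x = 1"
      using den[of x] by (simp add: \<beta>_def)
    then have "H x n = 0"
      by (simp add: H_def qn)
    then have "h x n = 0"
      by (simp add: h_def sphere_normalize_def)
    then show ?thesis
      using E_iff x conth by (auto simp: continuous_map_nsphere_iff S_def)
  qed
  have "Brouwer_degree2 n f = Brouwer_degree2 n (\<lambda>x. sphere_normalize n (f x))"
    by (rule Brouwer_degree2_eq) (use f(2) in \<open>simp add: sphere_normalize_ident S_def\<close>)
  also have "\<dots> = Brouwer_degree2 n (\<lambda>x. sphere_normalize n (F x))"
    by (rule Brouwer_degree2_normalize_homotopic)
       (use f(1) contF F_large e in \<open>force simp: S_def intro: continuous_on_product_then_coordinatewise\<close>)+
  also have "\<dots> = Brouwer_degree2 n h"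
    unfolding h_def
    by (rule Brouwer_degree2_normalize_homotopic) (use contF contH segment in \<open>auto simp: S_def\<close>)
  finally have deg: "Brouwer_degree2 n f = Brouwer_degree2 n h" .
  have "even (Brouwer_degree2 n h - Brouwer_degree2 (n - Suc 0) h)"
    by (rule Borsuk_odd_mapping_degree_step[OF conth]) (use hodd hE in \<open>auto simp: S_def E_def n_def o_def\<close>)
  moreover have "odd (Brouwer_degree2 m h)"
  proof (rule Suc.IH)
    show "continuous_map (nsphere m) (nsphere m) h"
      using conth hE ES unfolding continuous_map_nsphere_iff
      by (auto simp: E_def S_def intro: continuous_on_subset)
    show "h (\<lambda>i. - x i) = (\<lambda>i. - h x i)" if "x \<in> topspace (nsphere m)" for x
      using hodd that ES by (auto simp: E_def)
  qed
  ultimately show ?case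
    using deg by (simp add: n_def)
qed

text \<open>
  With at most \<open>n\<close> target coordinates the normalized map would miss the pole of the \<open>n\<close>-sphere in
  the last coordinate direction, so its degree would be \<open>0\<close>, whereas the degree of an odd map is odd.
\<close>

theorem Borsuk_Ulam:
  assumes cont: "continuous_map (nsphere n) (Euclidean_space j) f"
    and odd: "\<And>x. x \<in> topspace (nsphere n) \<Longrightarrow> f (\<lambda>i. - x i) = (\<lambda>i. - f x i)"
    and nz: "\<And>x. x \<in> topspace (nsphere n) \<Longrightarrow> f x \<noteq> (\<lambda>i. 0)"
  shows "n < j"
proof (rule ccontr)
  assume "\<not> n < j"
  define h where "h x = sphere_normalize n (f x)" for x
  have f0: "f x i = 0" if "x \<in> topspace (nsphere n)" "n \<le> i" for x i
    using continuous_map_image_subset_topspace[OF cont] that \<open>\<not> n < j\<close> by (auto simp: topspace_Euclidean_space image_subset_iff Pi_iff)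
  have fnz: "\<exists>i\<le>n. f x i \<noteq> 0" if "x \<in> topspace (nsphere n)" for x
    using nz[OF that] f0[OF that] by (meson ext nat_le_linear)
  have "continuous_on (topspace (nsphere n)) f"
  proof -
    have "continuous_map (nsphere n) euclidean f"
      using cont by (simp add: Euclidean_space_def euclidean_product_topology continuous_map_in_subtopology)
    then have "continuous_map (top_of_set (topspace (nsphere n))) euclidean f"
      by (simp flip: nsphere_top_of_set)
    then show ?thesis
      by (simp only: continuous_map_iff_continuous)
  qed
  then have h: "continuous_map (nsphere n) (nsphere n) h"
    unfolding continuous_map_nsphere_iff h_def
    by (auto intro!: continuous_on_sphere_normalize sphere_normalize_in_nsphere fnz
        intro: continuous_on_product_then_coordinatewise)
  moreover have "h (\<lambda>i. - x i) = (\<lambda>i. - h x i)" if "x \<in> topspace (nsphere n)" for x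
    using odd[OF that] by (simp add: h_def sphere_normalize_uminus)
  ultimately have "odd (Brouwer_degree2 n h)"
    by (rule odd_map_Brouwer_degree2)
  moreover have "Brouwer_degree2 n h = 0"
  proof (rule Brouwer_degree2_nonsurjective[OF h])
    have pole: "(\<lambda>i. if i = n then 1 else 0) \<in> topspace (nsphere n)"
      by (simp add: topspace_nsphere if_distrib[of "\<lambda>x. x\<^sup>2"] cong: if_cong)
    have "h x \<noteq> (\<lambda>i. if i = n then 1 else 0)" if "x \<in> topspace (nsphere n)" for x
    proof -
      have "h x n = 0"
        using f0[OF that] by (simp add: h_def sphere_normalize_def)
      then show ?thesis
        by auto
    qed
    then show "h ` topspace (nsphere n) \<noteq> topspace (nsphere n)"
      using pole by (metis imageE)
  qed
  ultimately show False
    by simp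
qed

section \<open>Convexity of the p-th power\<close>

lemma abs_mult_Phi: "x * Phi p x = \<bar>x\<bar> powr p"
proof (cases "x = 0")
  case False
  then show ?thesis
    by (simp add: Phi_def powr_diff power2_eq_square)
qed (simp add: Phi_def)

lemma Phi_0 [simp]: "Phi p 0 = 0"
  by (simp add: Phi_def)

lemma Phi_minus: "Phi p (- x) = - Phi p x"
  by (simp add: Phi_def)

lemma Phi_pos: "0 < x \<Longrightarrow> Phi p x = x powr (p - 1)"
proof -
  assume x: "0 < x"
  then have "Phi p x = x powr (p - 2) * x powr 1"
    by (simp add: Phi_def)
  also have "\<dots> = x powr (p - 2 + 1)"
    by (simp only: powr_add)
  finally show ?thesis
    by simp
qed

lemma Phi_mult: "Phi p (a * b) = Phi p a * Phi p b"
  by (simp add: Phi_def abs_mult powr_mult)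

lemma Phi_pos_iff: "0 < Phi p x \<longleftrightarrow> 0 < x"
  by (cases "x = 0") (auto simp: Phi_def zero_less_mult_iff)

lemma Phi_strict_mono:
  assumes p: "1 < p" and "x < y"
  shows "Phi p x < Phi p y"
proof -
  have pos: "Phi p a < Phi p b" if "0 \<le> a" "a < b" for a b
  proof (cases "a = 0")
    case True
    then show ?thesis
      using that Phi_pos_iff by simp
  next
    case False
    then show ?thesis
      using that p by (simp add: Phi_pos powr_less_mono2)
  qed
  consider "0 \<le> x" | "y \<le> 0" | "x < 0" "0 < y"
    using \<open>x < y\<close> by linarith
  then show ?thesis
  proof cases
    case 2
    then show ?thesis
      using pos[of "- y" "- x"] \<open>x < y\<close> by (simp add: Phi_minus)
  next
    case 3
    then have "0 < Phi p (- x)" "0 < Phi p y"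
      by (simp_all add: Phi_pos_iff)
    then show ?thesis
      by (simp add: Phi_minus)
  qed (use pos \<open>x < y\<close> in blast)
qed

lemma Phi_inject: "1 < p \<Longrightarrow> Phi p x = Phi p y \<longleftrightarrow> x = y"
  by (metis Phi_strict_mono linorder_less_linear order_less_irrefl)

text \<open>
  At \<open>0\<close> the difference quotient is bounded by \<open>\<bar>h\<bar> powr (p - 1)\<close>, which is where \<open>p > 1\<close> enters.
\<close>

lemma DERIV_abs_powr:
  assumes "1 < p"
  shows "((\<lambda>x. \<bar>x\<bar> powr p) has_real_derivative p * Phi p x) (at x)"
proof -
  have pos: "((\<lambda>x. \<bar>x\<bar> powr p) has_real_derivative p * Phi p x) (at x)" if "0 < x" for x
  proof -
    have "((\<lambda>x. x powr p) has_real_derivative p * x powr (p - 1)) (at x)"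
      using that by (auto intro!: derivative_eq_intros)
    moreover have "\<forall>\<^sub>F y in nhds x. y powr p = \<bar>y\<bar> powr p"
      using eventually_nhds_in_open[of "{0<..}" x] that by (auto elim: eventually_mono)
    ultimately show ?thesis
      using that by (subst (asm) DERIV_cong_ev[OF refl _ refl]) (auto simp: Phi_pos)
  qed
  consider "0 < x" | "x < 0" | "x = 0"
    by linarith
  then show ?thesis
  proof cases
    case 2
    then have "((\<lambda>x. \<bar>- x\<bar> powr p) has_real_derivative p * Phi p (- x) * - 1) (at x)"
      by (intro DERIV_chain2[OF pos]) (auto intro!: derivative_eq_intros)
    then show ?thesis
      by (simp add: Phi_minus)
  next
    case 3
    have "((\<lambda>h. \<bar>h\<bar> powr p / h) \<longlongrightarrow> 0) (at (0::real))"
    proof (rule Lim_null_comparison)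
      have "norm (\<bar>h\<bar> powr p / h) \<le> \<bar>h\<bar> powr (p - 1)" if "h \<noteq> 0" for h :: real
        using that by (simp add: powr_diff)
      then show "\<forall>\<^sub>F h in at (0::real). norm (\<bar>h\<bar> powr p / h) \<le> \<bar>h\<bar> powr (p - 1)"
        by (auto simp: eventually_at_filter)
      have "((\<lambda>h. \<bar>h\<bar> powr (p - 1)) \<longlongrightarrow> \<bar>0\<bar> powr (p - 1)) (at (0::real))"
        using assms by (intro tendsto_intros) auto
      then show "((\<lambda>h. \<bar>h\<bar> powr (p - 1)) \<longlongrightarrow> 0) (at (0::real))"
        by simp
    qed
    then show ?thesis
      using 3 assms by (simp add: DERIV_def)
  qed (use pos in blast)
qed

text \<open>
  The mean value theorem and the strict monotonicity of the derivative. This inequality is the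
  only form in which convexity is used, both for single edges and for the whole energy.
\<close>

lemma abs_powr_above_tangent_strict:
  assumes p: "1 < p" and "a \<noteq> b"
  shows "\<bar>b\<bar> powr p + p * Phi p b * (a - b) < \<bar>a\<bar> powr p"
proof (cases a b rule: linorder_cases)
  case greater
  then obtain z where z: "b < z" "z < a" "\<bar>a\<bar> powr p - \<bar>b\<bar> powr p = (a - b) * (p * Phi p z)"
    using MVT2[of b a "\<lambda>x. \<bar>x\<bar> powr p" "\<lambda>x. p * Phi p x"] DERIV_abs_powr[OF p] by blast
  then have "(a - b) * (p * Phi p b) < (a - b) * (p * Phi p z)"
    using p greater Phi_strict_mono by (intro mult_strict_left_mono) auto
  then show ?thesis
    using z by (simp add: algebra_simps)
next
  case less
  then obtain z where z: "a < z" "z < b" "\<bar>b\<bar> powr p - \<bar>a\<bar> powr p = (b - a) * (p * Phi p z)"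
    using MVT2[of a b "\<lambda>x. \<bar>x\<bar> powr p" "\<lambda>x. p * Phi p x"] DERIV_abs_powr[OF p] by blast
  then have "(b - a) * (p * Phi p z) < (b - a) * (p * Phi p b)"
    using p less Phi_strict_mono by (intro mult_strict_left_mono) auto
  then show ?thesis
    using z by (simp add: algebra_simps)
qed (use \<open>a \<noteq> b\<close> in simp)

lemma abs_powr_above_tangent:
  assumes "1 < p"
  shows "\<bar>b\<bar> powr p + p * Phi p b * (a - b) \<le> \<bar>a\<bar> powr p"
  using abs_powr_above_tangent_strict[OF assms, of a b] by (cases "a = b") auto

text \<open>
  Jensen's inequality for the weights \<open>a / (a + b)\<close> and \<open>b / (a + b)\<close>, from the tangents at the
  weighted mean \<open>y\<close> of \<open>c\<close> and \<open>d\<close>; the factor \<open>(a + b) powr p\<close> is written as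
  \<open>Phi p (a + b) * (a + b)\<close>, the shape in which an edge enters the summation by parts.
\<close>

lemma abs_powr_convex_combination:
  assumes p: "1 < p" and ab: "0 < a" "0 < b"
  shows "\<bar>c * a + d * b\<bar> powr p \<le> Phi p (a + b) * (\<bar>c\<bar> powr p * a + \<bar>d\<bar> powr p * b)"
    and "c \<noteq> d \<Longrightarrow> \<bar>c * a + d * b\<bar> powr p < Phi p (a + b) * (\<bar>c\<bar> powr p * a + \<bar>d\<bar> powr p * b)"
proof -
  define y where "y = (c * a + d * b) / (a + b)"
  have y: "y * (a + b) = c * a + d * b"
    using ab by (simp add: y_def)
  have Phi: "0 < Phi p (a + b)"
    using ab by (simp add: Phi_pos_iff)
  have lhs: "\<bar>c * a + d * b\<bar> powr p = Phi p (a + b) * (\<bar>y\<bar> powr p * (a + b))"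
  proof -
    have "\<bar>c * a + d * b\<bar> powr p = \<bar>y\<bar> powr p * ((a + b) * Phi p (a + b))"
      unfolding abs_mult_Phi by (simp add: powr_mult abs_mult flip: y)
    then show ?thesis
      by (simp only: mult_ac)
  qed
  \<comment> \<open>The linear parts of the two tangents cancel, because \<open>y\<close> is the weighted mean.\<close>
  have split: "\<bar>c\<bar> powr p * a + \<bar>d\<bar> powr p * b - \<bar>y\<bar> powr p * (a + b)
      = a * (\<bar>c\<bar> powr p - (\<bar>y\<bar> powr p + p * Phi p y * (c - y)))
        + b * (\<bar>d\<bar> powr p - (\<bar>y\<bar> powr p + p * Phi p y * (d - y)))"
  proof -
    define t where "t = p * Phi p y"
    have "a * (t * (c - y)) + b * (t * (d - y)) = t * (c * a + d * b - y * (a + b))"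
      by (simp add: algebra_simps)
    then have "a * (t * (c - y)) + b * (t * (d - y)) = 0"
      using y by simp
    then show ?thesis
      unfolding t_def[symmetric] by (simp add: algebra_simps)
  qed
  have nonneg: "0 \<le> a * (\<bar>c\<bar> powr p - (\<bar>y\<bar> powr p + p * Phi p y * (c - y)))"
    "0 \<le> b * (\<bar>d\<bar> powr p - (\<bar>y\<bar> powr p + p * Phi p y * (d - y)))"
    using ab abs_powr_above_tangent[OF p, of y] by (simp_all add: mult_nonneg_nonneg)
  then have "\<bar>y\<bar> powr p * (a + b) \<le> \<bar>c\<bar> powr p * a + \<bar>d\<bar> powr p * b"
    using split by linarith
  then show "\<bar>c * a + d * b\<bar> powr p \<le> Phi p (a + b) * (\<bar>c\<bar> powr p * a + \<bar>d\<bar> powr p * b)"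
    unfolding lhs using Phi by (intro mult_left_mono) auto
  assume "c \<noteq> d"
  then have "c \<noteq> y"
    using y ab by (auto simp: distrib_left)
  then have "0 < a * (\<bar>c\<bar> powr p - (\<bar>y\<bar> powr p + p * Phi p y * (c - y)))"
    using ab abs_powr_above_tangent_strict[OF p, of c y] by simp
  then have "\<bar>y\<bar> powr p * (a + b) < \<bar>c\<bar> powr p * a + \<bar>d\<bar> powr p * b"
    using split nonneg(2) by linarith
  then show "\<bar>c * a + d * b\<bar> powr p < Phi p (a + b) * (\<bar>c\<bar> powr p * a + \<bar>d\<bar> powr p * b)"
    unfolding lhs using Phi by (intro mult_strict_left_mono) auto
qed

section \<open>Energy, mass and the graph p-Laplacian\<close>

definition dirichlet_energy :: "('v::finite \<Rightarrow> 'v \<Rightarrow> real) \<Rightarrow> real \<Rightarrow> ('v \<Rightarrow> real) \<Rightarrow> real" where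
  "dirichlet_energy w p g = 1 / 2 * (\<Sum>u\<in>UNIV. \<Sum>v\<in>UNIV. w u v * \<bar>g u - g v\<bar> powr p)"

definition p_mass :: "('v::finite \<Rightarrow> real) \<Rightarrow> real \<Rightarrow> ('v \<Rightarrow> real) \<Rightarrow> real" where
  "p_mass \<mu> p g = (\<Sum>u\<in>UNIV. \<mu> u * \<bar>g u\<bar> powr p)"

lemma rayleigh_eq_energy_div_mass: "rayleigh \<mu> w p g = dirichlet_energy w p g / p_mass \<mu> p g"
  by (simp add: rayleigh_def dirichlet_energy_def p_mass_def)

context weighted_graph
begin

lemma edge_weight_nonneg: "0 \<le> w u v"
  using edge_weight_pos[of u v] edge_weight_zero[of u v] by (cases "(u, v) \<in> parcs G") auto

text \<open>
  The discrete Green formula: exchanging the two ends of every edge changes the sign of \<open>Phi\<close>, as the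
  weights are symmetric.
\<close>

lemma summation_by_parts:
  "(\<Sum>u\<in>UNIV. d u * p_laplacian w p g u)
     = 1 / 2 * (\<Sum>u\<in>UNIV. \<Sum>v\<in>UNIV. w u v * (Phi p (g u - g v) * (d u - d v)))"
proof -
  have flip: "w v u * (Phi p (g v - g u) * d v) = - (w u v * (Phi p (g u - g v) * d v))" for u v
    using edge_weight_sym[of u v] Phi_minus[of p "g u - g v"] by simp
  have A: "(\<Sum>u\<in>UNIV. d u * p_laplacian w p g u) = (\<Sum>u\<in>UNIV. \<Sum>v\<in>UNIV. w u v * (Phi p (g u - g v) * d u))"
    by (simp add: p_laplacian_def sum_distrib_left mult_ac)
  also have "\<dots> = (\<Sum>u\<in>UNIV. \<Sum>v\<in>UNIV. w v u * (Phi p (g v - g u) * d v))"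
    by (rule sum.swap)
  also have "\<dots> = - (\<Sum>u\<in>UNIV. \<Sum>v\<in>UNIV. w u v * (Phi p (g u - g v) * d v))"
    unfolding flip by (simp add: sum_negf)
  finally have B: "(\<Sum>u\<in>UNIV. d u * p_laplacian w p g u) = - (\<Sum>u\<in>UNIV. \<Sum>v\<in>UNIV. w u v * (Phi p (g u - g v) * d v))" .
  show ?thesis
    using A B by (simp add: right_diff_distrib sum_subtractf)
qed

lemma energy_eq_laplacian: "dirichlet_energy w p g = (\<Sum>u\<in>UNIV. g u * p_laplacian w p g u)"
  unfolding summation_by_parts dirichlet_energy_def by (simp add: mult.commute[of "Phi _ _"] abs_mult_Phi)

text \<open>
  The energy is convex with gradient \<open>p * p_laplacian w p h\<close> at \<open>h\<close>: this is the tangent inequality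
  on every edge, summed by parts.
\<close>

lemma energy_above_tangent:
  assumes "1 < p"
  shows "dirichlet_energy w p h + p * (\<Sum>u\<in>UNIV. (g u - h u) * p_laplacian w p h u) \<le> dirichlet_energy w p g"
proof -
  have "(\<Sum>u\<in>UNIV. \<Sum>v\<in>UNIV. w u v * (\<bar>h u - h v\<bar> powr p + p * Phi p (h u - h v) * ((g u - g v) - (h u - h v))))
      \<le> (\<Sum>u\<in>UNIV. \<Sum>v\<in>UNIV. w u v * \<bar>g u - g v\<bar> powr p)"
    by (intro sum_mono mult_left_mono abs_powr_above_tangent assms edge_weight_nonneg)
  moreover have "w u v * (\<bar>h u - h v\<bar> powr p + p * Phi p (h u - h v) * ((g u - g v) - (h u - h v)))
      = w u v * \<bar>h u - h v\<bar> powr p + p * (w u v * (Phi p (h u - h v) * ((g u - h u) - (g v - h v))))" for u v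
    by (simp add: algebra_simps)
  ultimately have "(\<Sum>u\<in>UNIV. \<Sum>v\<in>UNIV. w u v * \<bar>h u - h v\<bar> powr p)
       + p * (\<Sum>u\<in>UNIV. \<Sum>v\<in>UNIV. w u v * (Phi p (h u - h v) * ((g u - h u) - (g v - h v))))
      \<le> (\<Sum>u\<in>UNIV. \<Sum>v\<in>UNIV. w u v * \<bar>g u - g v\<bar> powr p)"
    by (simp add: sum.distrib flip: sum_distrib_left)
  then show ?thesis
    unfolding summation_by_parts dirichlet_energy_def by simp
qed

lemma p_mass_nonneg: "0 \<le> p_mass \<mu> p g"
  unfolding p_mass_def using vertex_weight_pos by (intro sum_nonneg mult_nonneg_nonneg) (auto intro: less_imp_le)

lemma p_mass_pos:
  assumes "g u \<noteq> 0"
  shows "0 < p_mass \<mu> p g"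
  unfolding p_mass_def
proof (rule sum_pos2)
  show "0 < \<mu> u * \<bar>g u\<bar> powr p"
    using assms vertex_weight_pos by simp
  show "0 \<le> \<mu> v * \<bar>g v\<bar> powr p" for v
    using vertex_weight_pos[of v] by simp
qed auto

lemma energy_nonneg: "0 \<le> dirichlet_energy w p g"
  unfolding dirichlet_energy_def using edge_weight_nonneg by (simp add: sum_nonneg)

end

context weighted_graph
begin

lemma adj_sym: "(u, v) \<in> parcs G \<Longrightarrow> (v, u) \<in> parcs G"
  using pair_sym_arcs by (auto simp: symmetric_def dest: symD)

section \<open>Connected components of induced subgraphs\<close>

text \<open>
  The form in which connectedness of the graph is used: a property that passes along edges
  and holds somewhere holds everywhere.
\<close>

lemma connected_induct:
  assumes "P u" and step: "\<And>x y. \<lbrakk>P x; (x, y) \<in> parcs G\<rbrakk> \<Longrightarrow> P y"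
  shows "P v"
proof -
  have "strongly_connected (with_proj G)"
    using symmetric_connected_imp_strongly_connected[OF pair_sym_arcs graph_connected] .
  then have "u \<rightarrow>\<^sup>*\<^bsub>with_proj G\<^esub> v"
    using verts_UNIV by (auto simp: strongly_connected_def)
  then show ?thesis
  proof (induction rule: reachable_induct)
    case (step x y)
    then show ?case
      using assms(2)[of x y] by simp
  qed (use assms in auto)
qed

definition component_of :: "'v set \<Rightarrow> 'v set \<Rightarrow> bool" where
  "component_of A X \<longleftrightarrow> with_proj G \<restriction> A \<in> pre_digraph.sccs (with_proj G \<restriction> X)"

lemma component_of_sccs_verts:
  assumes "component_of A X"
  shows "A \<in> pre_digraph.sccs_verts (with_proj G \<restriction> X)"
proof -
  interpret H: wf_digraph "with_proj G \<restriction> X"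
    by (rule wellformed_induce_subgraph)
  have "verts (with_proj G \<restriction> A) \<in> verts ` H.sccs"
    using assms unfolding component_of_def by (rule imageI)
  then show ?thesis
    unfolding induce_subgraph_verts by (rule H.in_sccs_vertsI_sccs)
qed

lemma component_of_nonempty: "component_of A X \<Longrightarrow> A \<noteq> {}"
  using component_of_sccs_verts by (auto simp: pre_digraph.sccs_verts_def)

lemma component_of_subset:
  assumes "component_of A X"
  shows "A \<subseteq> X"
proof
  fix u
  assume u: "u \<in> A"
  interpret H: wf_digraph "with_proj G \<restriction> X"
    by (rule wellformed_induce_subgraph)
  have "u \<rightarrow>\<^sup>*\<^bsub>with_proj G \<restriction> X\<^esub> u"
    using component_of_sccs_verts[OF assms] u by (auto simp: H.sccs_verts_def)
  then show "u \<in> X"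
    using H.reachable_in_verts by auto
qed

lemma component_of_disjoint:
  assumes "component_of A X" "component_of B X" "u \<in> A" "u \<in> B"
  shows "A = B"
proof -
  interpret H: wf_digraph "with_proj G \<restriction> X"
    by (rule wellformed_induce_subgraph)
  show ?thesis
    using H.sccs_verts_disjoint[OF component_of_sccs_verts component_of_sccs_verts, OF assms(1,2)] assms(3,4) by blast
qed

lemma component_of_adj_closed:
  assumes A: "component_of A X" and u: "u \<in> A" and v: "v \<in> X" and uv: "(u, v) \<in> parcs G"
  shows "v \<in> A"
proof -
  interpret H: wf_digraph "with_proj G \<restriction> X"
    by (rule wellformed_induce_subgraph)
  have adj: "x \<rightarrow>\<^bsub>with_proj G \<restriction> X\<^esub> y" if "x \<in> X" "y \<in> X" "(x, y) \<in> parcs G" for x y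
    using that by (auto simp: arcs_ends_conv intro!: image_eqI[of _ _ "(x, y)"])
  have "u \<in> X"
    using component_of_subset[OF A] u by blast
  then have "u \<rightarrow>\<^sup>*\<^bsub>with_proj G \<restriction> X\<^esub> v" "v \<rightarrow>\<^sup>*\<^bsub>with_proj G \<restriction> X\<^esub> u"
    using adj[of u v] adj[of v u] v uv adj_sym by auto
  then show ?thesis
    using component_of_sccs_verts[OF A] u by (auto simp: H.sccs_verts_def)
qed

end

section \<open>Combinations of nodal domains\<close>

text \<open>
  The contribution of one edge, when its end values \<open>a\<close> and \<open>b\<close> are multiplied by \<open>c\<close> and \<open>d\<close>. Equality
  holds if the signs agree, because then \<open>c = d\<close>, or if one end is a zero; for opposite signs this is Jensen's
  inequality.
\<close>

lemma edge_energy_le: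
  assumes p: "1 < p" and "0 < a * b \<Longrightarrow> c = d"
  shows "\<bar>c * a - d * b\<bar> powr p \<le> Phi p (a - b) * (\<bar>c\<bar> powr p * a - \<bar>d\<bar> powr p * b)"
proof -
  have opposite: "\<bar>c * a - d * b\<bar> powr p \<le> Phi p (a - b) * (\<bar>c\<bar> powr p * a - \<bar>d\<bar> powr p * b)"
    if "0 < a" "b < 0" for a b c d
    using abs_powr_convex_combination(1)[OF p, of a "- b" c d] that by simp
  have absorb: "\<bar>c * x\<bar> powr p = Phi p x * (\<bar>c\<bar> powr p * x)" for c x
    by (simp add: abs_mult powr_mult mult_ac flip: abs_mult_Phi[of x])
  consider "0 < a * b" | "a = 0" | "b = 0" | "0 < a" "b < 0" | "a < 0" "0 < b"
    by (cases a "0::real" rule: linorder_cases; cases b "0::real" rule: linorder_cases)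
       (auto simp: zero_less_mult_iff)
  then show ?thesis
  proof cases
    case 1
    then have "c = d"
      by (rule assms(2))
    then show ?thesis
      using absorb[of d "a - b"] by (simp add: right_diff_distrib)
  next
    case 2
    then show ?thesis
      using absorb[of d b] by (simp add: Phi_minus)
  next
    case 3
    then show ?thesis
      using absorb[of c a] by simp
  next
    case 4
    then show ?thesis
      by (rule opposite)
  next
    case 5
    then show ?thesis
      using opposite[of b a d c] Phi_minus[of p "b - a"] by (simp add: abs_minus_commute algebra_simps)
  qed
qed

lemma edge_energy_less:
  assumes "1 < p" "0 < a" "b < 0" "c \<noteq> d"
  shows "\<bar>c * a - d * b\<bar> powr p < Phi p (a - b) * (\<bar>c\<bar> powr p * a - \<bar>d\<bar> powr p * b)"
  using abs_powr_convex_combination(2)[of p a "- b" c d] assms by simp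

text \<open>
  The \<open>k + 1\<close> domains \<open>e 0, \<dots>, e k\<close> are those of the contradictory assumption. The eigenvalue
  \<open>lam\<close> is kept arbitrary: what is shown about it is that it exceeds the \<open>k\<close>-th variational
  eigenvalue.
\<close>

locale eigenfunction_with_nodal_domains = weighted_graph G \<mu> w
  for G :: "('v::finite) pair_pre_digraph" and \<mu> w +
  fixes p lam :: real and f :: "'v \<Rightarrow> real" and k :: nat and e :: "nat \<Rightarrow> 'v set"
  assumes p_gt_1: "1 < p"
    and eigen: "eigenfunction \<mu> w p lam f"
    and domains: "i \<le> k \<Longrightarrow> weak_nodal_domain G f (e i)"
    and domains_inj: "inj_on e {..k}"
begin

lemma f_nonzero: "\<exists>u. f u \<noteq> 0"
  using eigen by (simp add: eigenfunction_def)

lemma laplacian_f: "p_laplacian w p f u = lam * \<mu> u * Phi p (f u)"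
  using eigen by (simp add: eigenfunction_def)

lemma eigenvalue_nonneg: "0 \<le> lam"
proof -
  obtain u where "f u \<noteq> 0"
    using f_nonzero by blast
  have "dirichlet_energy w p f = lam * p_mass \<mu> p f"
    unfolding energy_eq_laplacian laplacian_f p_mass_def
    by (simp add: sum_distrib_left mult_ac flip: abs_mult_Phi)
  then have "0 \<le> lam * p_mass \<mu> p f"
    using energy_nonneg[of p f] by simp
  then show ?thesis
    using p_mass_pos[of f u p] \<open>f u \<noteq> 0\<close> by (simp add: zero_le_mult_iff)
qed

text \<open>
  The sign \<open>s\<close> is \<open>1\<close> or \<open>-1\<close>, which lets one argument cover the components of \<open>f \<ge> 0\<close> and those
  of \<open>f \<le> 0\<close>.
\<close>

definition has_sign :: "real \<Rightarrow> 'v set \<Rightarrow> bool" where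
  "has_sign s A \<longleftrightarrow> component_of A {u. 0 \<le> s * f u}"

lemma domain_has_sign:
  assumes "i \<le> k"
  obtains s where "s \<in> {1, -1}" "has_sign s (e i)"
  using domains[OF assms] that[of 1] that[of "-1"]
  by (auto simp: weak_nodal_domain_def has_sign_def component_of_def)

text \<open>
  At a zero of \<open>f\<close> the eigenvalue equation says that the weighted sum of \<open>Phi p (f v)\<close> over the
  neighbours is \<open>0\<close>, so a negative term needs a positive one.
\<close>

lemma neighbour_of_opposite_sign:
  assumes u: "f u = 0" and v: "(u, v) \<in> parcs G" "s * f v < 0" and s: "s \<in> {1, -1}"
  obtains v' where "(u, v') \<in> parcs G" "0 < s * f v'"
proof -
  have zero: "(\<Sum>v\<in>UNIV. w u v * Phi p (s * f v)) = 0"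
  proof -
    have "(\<Sum>v\<in>UNIV. w u v * Phi p (s * f v)) = - s * p_laplacian w p f u"
      using s by (auto simp: p_laplacian_def u Phi_minus sum_negf)
    then show ?thesis
      by (simp add: laplacian_f u)
  qed
  have "\<exists>v'. 0 < w u v' * Phi p (s * f v')"
  proof (rule ccontr)
    assume "\<not> ?thesis"
    then have "\<And>v'. w u v' * Phi p (s * f v') \<le> 0"
      by (simp add: not_less)
    moreover have "w u v * Phi p (s * f v) < 0"
      using edge_weight_pos[OF v(1)] v(2) Phi_pos_iff[of p "- (s * f v)"] by (simp add: Phi_minus mult_pos_neg)
    ultimately have "(\<Sum>v\<in>UNIV. w u v * Phi p (s * f v)) < (\<Sum>v\<in>(UNIV::'v set). 0)"
      by (intro sum_strict_mono_ex1) auto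
    then show False
      using zero by simp
  qed
  then obtain v' where v': "0 < w u v' * Phi p (s * f v')"
    by blast
  then have "w u v' \<noteq> 0" "0 < Phi p (s * f v')"
    using edge_weight_nonneg[of u v'] by (auto simp: zero_less_mult_iff)
  then show ?thesis
    using that[of v'] edge_weight_zero by (auto simp: Phi_pos_iff)
qed

text \<open>
  For \<open>s = 1\<close>: a component of \<open>f \<ge> 0\<close> consisting of zeros only could not be left: a neighbour outside would
  be negative, hence accompanied by a positive neighbour, which would belong to the component.
  It would be the whole graph, against \<open>f \<noteq> 0\<close>.
\<close>

lemma has_sign_strict:
  assumes A: "has_sign s A" and s: "s \<in> {1, -1}"
  obtains u where "u \<in> A" "0 < s * f u"
proof -
  have comp: "component_of A {u. 0 \<le> s * f u}"
    using A by (simp add: has_sign_def)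
  have "\<exists>u\<in>A. f u \<noteq> 0"
  proof (rule ccontr)
    assume "\<not> ?thesis"
    then have zero: "\<And>u. u \<in> A \<Longrightarrow> f u = 0"
      by blast
    obtain u where "u \<in> A"
      using component_of_nonempty[OF comp] by blast
    then have "v \<in> A" for v
    proof (rule connected_induct)
      fix x y
      assume x: "x \<in> A" and xy: "(x, y) \<in> parcs G"
      have "0 \<le> s * f y"
      proof (rule ccontr)
        assume "\<not> ?thesis"
        then obtain v where v: "(x, v) \<in> parcs G" "0 < s * f v"
          using neighbour_of_opposite_sign[OF zero[OF x] xy _ s] by (auto simp: not_le)
        then have "v \<in> A"
          using component_of_adj_closed[OF comp x _ v(1)] by simp
        then show False
          using zero v by simp
      qed
      then show "y \<in> A"
        using component_of_adj_closed[OF comp x _ xy] by simp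
    qed
    then show False
      using zero f_nonzero by blast
  qed
  then obtain u where "u \<in> A" "f u \<noteq> 0"
    by blast
  moreover have "0 \<le> s * f u"
    using component_of_subset[OF comp] \<open>u \<in> A\<close> by blast
  ultimately show ?thesis
    using that[of u] s by auto
qed

lemma has_sign_nonneg: "has_sign s A \<Longrightarrow> u \<in> A \<Longrightarrow> 0 \<le> s * f u"
  using component_of_subset by (auto simp: has_sign_def)

text \<open>
  The coefficient of the domain of sign \<open>s\<close> that contains \<open>u\<close>. A zero of \<open>f\<close> lies in domains of both signs,
  so it carries two coefficients, \<open>coef 1 x u\<close> and \<open>coef (-1) x u\<close>; the rigidity argument is about
  their equality. As the sum stops before \<open>k\<close>, the domain \<open>e k\<close> has coefficient \<open>0\<close>.
\<close>

definition coef :: "real \<Rightarrow> (nat \<Rightarrow> real) \<Rightarrow> 'v \<Rightarrow> real" where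
  "coef s x u = (\<Sum>i<k. x i * of_bool (u \<in> e i \<and> has_sign s (e i)))"

definition comb :: "(nat \<Rightarrow> real) \<Rightarrow> 'v \<Rightarrow> real" where
  "comb x u = (\<Sum>i<k. x i * (if u \<in> e i then f u else 0))"

lemma comb_eq_0: "f u = 0 \<Longrightarrow> comb x u = 0"
  by (simp add: comb_def cong: if_cong)

lemma comb_eq_coef:
  assumes s: "s \<in> {1, -1}" and u: "0 < s * f u"
  shows "comb x u = coef s x u * f u"
proof -
  have "has_sign s (e i)" if "i < k" "u \<in> e i" for i
  proof -
    obtain s' where s': "s' \<in> {1, -1}" "has_sign s' (e i)"
      using domain_has_sign[of i] \<open>i < k\<close> by (metis less_imp_le)
    then have "0 \<le> s' * f u"
      using has_sign_nonneg \<open>u \<in> e i\<close> by blast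
    then have "s' = s"
      using s' s u by auto
    then show ?thesis
      using s' by simp
  qed
  then show ?thesis
    unfolding comb_def coef_def sum_distrib_right by (intro sum.cong) auto
qed

lemma coef_adj:
  assumes "0 \<le> s * f u" "0 \<le> s * f v" and uv: "(u, v) \<in> parcs G"
  shows "coef s x u = coef s x v"
proof -
  have "u \<in> e i \<longleftrightarrow> v \<in> e i" if "has_sign s (e i)" for i
    using that assms component_of_adj_closed[of "e i" "{u. 0 \<le> s * f u}"] adj_sym[OF uv]
    unfolding has_sign_def by blast
  then show ?thesis
    unfolding coef_def by (intro sum.cong) auto
qed

lemma coef_on_domain:
  assumes j: "j \<le> k" "has_sign s (e j)" "u \<in> e j"
  shows "coef s x u = (if j < k then x j else 0)"
proof -
  have "u \<in> e i \<and> has_sign s (e i) \<longleftrightarrow> i = j" if "i < k" for i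
  proof -
    have "e i = e j" if "u \<in> e i" "has_sign s (e i)"
      using component_of_disjoint[of "e i" _ "e j" u] that j by (auto simp: has_sign_def)
    then show ?thesis
      using j \<open>i < k\<close> inj_onD[OF domains_inj, of i j] by auto
  qed
  then have "coef s x u = (\<Sum>i<k. if i = j then x i else 0)"
    unfolding coef_def by (intro sum.cong) auto
  then show ?thesis
    by simp
qed

definition amplitude :: "(nat \<Rightarrow> real) \<Rightarrow> 'v \<Rightarrow> real" where
  "amplitude x u = (if f u = 0 then 0 else coef (sgn (f u)) x u)"

lemma comb_eq_amplitude: "comb x u = amplitude x u * f u"
  using comb_eq_coef[of 1 u x] comb_eq_coef[of "-1" u x] comb_eq_0[of u x]
  by (auto simp: amplitude_def sgn_if)

lemma amplitude_adj:
  assumes "(u, v) \<in> parcs G" "0 < f u * f v"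
  shows "amplitude x u = amplitude x v"
  using assms coef_adj[of 1 u v x] coef_adj[of "-1" u v x]
  by (auto simp: amplitude_def sgn_if zero_less_mult_iff)

text \<open>
  The upper bounds of all edges add up to exactly \<open>lam\<close> times the mass: by parts they are the pairing of
  \<open>\<bar>amplitude\<bar> powr p * f\<close> with the Laplacian of \<open>f\<close>.
\<close>

lemma amplitude_energy_bound:
  "lam * p_mass \<mu> p (comb x)
     = 1 / 2 * (\<Sum>u\<in>UNIV. \<Sum>v\<in>UNIV. w u v *
         (Phi p (f u - f v) * (\<bar>amplitude x u\<bar> powr p * f u - \<bar>amplitude x v\<bar> powr p * f v)))"
proof -
  have "lam * p_mass \<mu> p (comb x) = (\<Sum>u\<in>UNIV. (\<bar>amplitude x u\<bar> powr p * f u) * p_laplacian w p f u)"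
    unfolding p_mass_def laplacian_f sum_distrib_left comb_eq_amplitude
  proof (rule sum.cong[OF refl])
    fix u
    show "lam * (\<mu> u * \<bar>amplitude x u * f u\<bar> powr p)
        = \<bar>amplitude x u\<bar> powr p * f u * (lam * \<mu> u * Phi p (f u))"
      by (simp add: abs_mult powr_mult mult_ac flip: abs_mult_Phi[of "f u"])
  qed
  then show ?thesis
    unfolding summation_by_parts .
qed

lemma edge_term_le:
  "w u v * \<bar>comb x u - comb x v\<bar> powr p
     \<le> w u v * (Phi p (f u - f v) * (\<bar>amplitude x u\<bar> powr p * f u - \<bar>amplitude x v\<bar> powr p * f v))"
proof (cases "(u, v) \<in> parcs G")
  case True
  then show ?thesis
    unfolding comb_eq_amplitude
    by (intro mult_left_mono edge_energy_le p_gt_1 edge_weight_nonneg) (rule amplitude_adj)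
qed (simp add: edge_weight_zero)

lemma energy_comb_le: "dirichlet_energy w p (comb x) \<le> lam * p_mass \<mu> p (comb x)"
  unfolding amplitude_energy_bound dirichlet_energy_def
  by (intro mult_left_mono sum_mono edge_term_le) auto

text \<open>
  A single edge with strict inequality would make the whole bound strict.
\<close>

lemma energy_comb_eq_imp_amplitude_eq:
  assumes eq: "dirichlet_energy w p (comb x) = lam * p_mass \<mu> p (comb x)"
    and uv: "(u, v) \<in> parcs G" "0 < f u" "f v < 0"
  shows "amplitude x u = amplitude x v"
proof (rule ccontr)
  assume ne: "amplitude x u \<noteq> amplitude x v"
  define lhs where "lhs u v = w u v * \<bar>comb x u - comb x v\<bar> powr p" for u v
  define rhs where "rhs u v = w u v * (Phi p (f u - f v) * (\<bar>amplitude x u\<bar> powr p * f u - \<bar>amplitude x v\<bar> powr p * f v))" for u v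
  have le: "lhs a b \<le> rhs a b" for a b
    unfolding lhs_def rhs_def by (rule edge_term_le)
  have "lhs u v < rhs u v"
    unfolding lhs_def rhs_def comb_eq_amplitude
    using edge_weight_pos[OF uv(1)] edge_energy_less[OF p_gt_1 uv(2,3) ne] by (rule mult_strict_left_mono[rotated])
  then have "(\<Sum>b\<in>UNIV. lhs u b) < (\<Sum>b\<in>UNIV. rhs u b)"
    using le by (intro sum_strict_mono_ex1) auto
  then have "(\<Sum>a\<in>UNIV. \<Sum>b\<in>UNIV. lhs a b) < (\<Sum>a\<in>UNIV. \<Sum>b\<in>UNIV. rhs a b)"
    using le by (intro sum_strict_mono_ex1) (auto intro: sum_mono)
  then show False
    using eq unfolding amplitude_energy_bound dirichlet_energy_def lhs_def rhs_def by simp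
qed

text \<open>
  All positive neighbours of the zero \<open>z\<close> lie in the same positive domain as \<open>z\<close>, and likewise for the negative
  ones. With \<open>P\<close> and \<open>N\<close> the weighted sums of \<open>Phi p \<bar>f v\<bar>\<close> over the two kinds, the
  equation of \<open>f\<close> at \<open>z\<close> reads \<open>N = P\<close>, and the one for the combination equates \<open>N\<close> and \<open>P\<close>
  multiplied by \<open>Phi p\<close> of the two coefficients. As \<open>P > 0\<close> and \<open>Phi p\<close> is injective, the coefficients agree.
\<close>

lemma critical_comb_imp_coef_eq_at_zero:
  assumes crit: "p_laplacian w p (comb x) z = 0" and z: "f z = 0"
    and v: "(z, v) \<in> parcs G" "f v \<noteq> 0"
  shows "coef 1 x z = coef (-1) x z"
proof -
  define P where "P = (\<Sum>u\<in>UNIV. w z u * Phi p (max (f u) 0))"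
  define N where "N = (\<Sum>u\<in>UNIV. w z u * Phi p (max (- f u) 0))"
  have comb: "w z u * Phi p (comb x z - comb x u)
      = Phi p (coef (-1) x z) * (w z u * Phi p (max (- f u) 0)) - Phi p (coef 1 x z) * (w z u * Phi p (max (f u) 0))" for u
  proof (cases "(z, u) \<in> parcs G")
    case True
    have "comb x u = coef 1 x z * f u" if "0 < f u"
      using comb_eq_coef[of 1 u x] coef_adj[of 1 z u x] z True that by simp
    moreover have "comb x u = coef (-1) x z * f u" if "f u < 0"
      using comb_eq_coef[of "-1" u x] coef_adj[of "-1" z u x] z True that by simp
    ultimately show ?thesis
      using comb_eq_0[of u x] comb_eq_0[OF z, of x]
      by (cases "f u" "0 :: real" rule: linorder_cases) (auto simp: Phi_minus Phi_mult max_def)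
  qed (simp add: edge_weight_zero)
  have "w z u * Phi p (f z - f u) = w z u * Phi p (max (- f u) 0) - w z u * Phi p (max (f u) 0)" for u
    using z by (cases "f u" "0 :: real" rule: linorder_cases) (auto simp: Phi_minus max_def)
  then have "p_laplacian w p f z = N - P"
    by (simp add: p_laplacian_def N_def P_def sum_subtractf)
  then have NP: "N = P"
    using z by (simp add: laplacian_f)
  have "p_laplacian w p (comb x) z = Phi p (coef (-1) x z) * N - Phi p (coef 1 x z) * P"
    unfolding p_laplacian_def comb by (simp add: N_def P_def sum_subtractf sum_distrib_left)
  then have "(Phi p (coef (-1) x z) - Phi p (coef 1 x z)) * P = 0"
    using crit NP by (auto simp: left_diff_distrib)
  moreover have "0 < P + N"
  proof -
    have "P + N = (\<Sum>u\<in>UNIV. w z u * (Phi p (max (f u) 0) + Phi p (max (- f u) 0)))"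
      by (simp add: P_def N_def sum.distrib distrib_left)
    also have "\<dots> > 0"
    proof (rule sum_pos2)
      have nonneg: "0 \<le> Phi p (max a 0)" for a
        using Phi_pos_iff[of p a] by (cases "0 < a") (auto simp: max_def)
      show "0 \<le> w z u * (Phi p (max (f u) 0) + Phi p (max (- f u) 0))" for u
        by (intro mult_nonneg_nonneg add_nonneg_nonneg nonneg edge_weight_nonneg)
      have "0 < Phi p (max (f v) 0) + Phi p (max (- f v) 0)"
        using v(2) by (cases "0 < f v") (auto simp: Phi_pos_iff max_def)
      then show "0 < w z v * (Phi p (max (f v) 0) + Phi p (max (- f v) 0))"
        using edge_weight_pos[OF v(1)] by simp
    qed auto
    finally show ?thesis .
  qed
  ultimately have "Phi p (coef (-1) x z) = Phi p (coef 1 x z)"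
    using NP by simp
  then show ?thesis
    using Phi_inject[OF p_gt_1] by simp
qed

text \<open>
  The coefficients agree wherever domains of opposite sign touch, along an edge or at a zero, so the
  coefficient \<open>0\<close> of \<open>e k\<close> spreads over the connected graph.
\<close>

lemma critical_comb_imp_zero:
  assumes eq: "dirichlet_energy w p (comb x) = lam * p_mass \<mu> p (comb x)"
    and crit: "\<And>z. f z = 0 \<Longrightarrow> p_laplacian w p (comb x) z = 0" and j: "j < k"
  shows "x j = 0"
proof -
  \<comment> \<open>Zeros without nonzero neighbours: a difference of the two coefficients would spread from zero to zero and never reach a nonzero vertex.\<close>
  have at_zero: "coef 1 x z = coef (-1) x z" if z: "f z = 0" for z
  proof (rule ccontr)
    assume ne: "coef 1 x z \<noteq> coef (-1) x z"
    have "f v = 0 \<and> coef 1 x v \<noteq> coef (-1) x v" for v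
    proof (rule connected_induct[where P = "\<lambda>v. f v = 0 \<and> coef 1 x v \<noteq> coef (-1) x v"])
      show "f z = 0 \<and> coef 1 x z \<noteq> coef (-1) x z"
        using z ne by simp
      fix a b
      assume a: "f a = 0 \<and> coef 1 x a \<noteq> coef (-1) x a" and ab: "(a, b) \<in> parcs G"
      then have "f b = 0"
        using critical_comb_imp_coef_eq_at_zero[OF crit _ ab] by blast
      then show "f b = 0 \<and> coef 1 x b \<noteq> coef (-1) x b"
        using a ab coef_adj[of 1 a b x] coef_adj[of "-1" a b x] by simp
    qed
    then show False
      using f_nonzero by blast
  qed
  have across: "coef s x v = coef (- s) x u"
    if "(u, v) \<in> parcs G" "s * f u < 0" "0 < s * f v" "s \<in> {1, -1}" for s u v
    using energy_comb_eq_imp_amplitude_eq[OF eq, of v u] energy_comb_eq_imp_amplitude_eq[OF eq, of u v]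
      that adj_sym[OF that(1)] by (auto simp: amplitude_def sgn_if)
  obtain s0 where s0: "s0 \<in> {1, -1}" "has_sign s0 (e k)"
    using domain_has_sign[of k] by blast
  obtain u0 where u0: "u0 \<in> e k" "0 < s0 * f u0"
    using has_sign_strict[OF s0(2,1)] by blast
  have vanish: "\<forall>s\<in>{1, -1}. 0 \<le> s * f v \<longrightarrow> coef s x v = 0" for v
  proof (rule connected_induct[where P = "\<lambda>v. \<forall>s\<in>{1, -1}. 0 \<le> s * f v \<longrightarrow> coef s x v = 0"])
    have "coef s0 x u0 = 0"
      using coef_on_domain[of k s0 u0 x] s0 u0 by simp
    then show "\<forall>s\<in>{1, -1}. 0 \<le> s * f u0 \<longrightarrow> coef s x u0 = 0"
      using s0 u0 by auto
  next
    fix u v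
    assume u: "\<forall>s\<in>{1, -1}. 0 \<le> s * f u \<longrightarrow> coef s x u = 0" and uv: "(u, v) \<in> parcs G"
    show "\<forall>s\<in>{1, -1}. 0 \<le> s * f v \<longrightarrow> coef s x v = 0"
    proof (intro ballI impI)
      fix s :: real
      assume s: "s \<in> {1, -1}" and v: "0 \<le> s * f v"
      show "coef s x v = 0"
      proof (cases "0 \<le> s * f u")
        case True
        then show ?thesis
          using u s by (auto simp flip: coef_adj[OF True v uv])
      next
        case False
        then have neg: "coef (- s) x u = 0"
          using u s by auto
        show ?thesis
        proof (cases "f v = 0")
          case True
          then have "coef (- s) x v = 0"
            using neg False coef_adj[of "- s" u v x] uv by simp
          then show ?thesis
            using at_zero[OF True] s by auto
        next
          case f_v: False
          then have "0 < s * f v"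
            using v s by auto
          then show ?thesis
            using across[OF uv _ _ s] False neg by simp
        qed
      qed
    qed
  qed
  obtain s where s: "s \<in> {1, -1}" "has_sign s (e j)"
    using domain_has_sign[of j] j by (metis less_imp_le)
  obtain u where u: "u \<in> e j" "0 < s * f u"
    using has_sign_strict[OF s(2,1)] by blast
  then have "coef s x u = 0"
    using vanish[of u] s by (auto dest: less_imp_le)
  then show ?thesis
    using coef_on_domain[of j s u x] j s u by simp
qed

lemma comb_nonzero:
  assumes j: "j < k" and x: "x j \<noteq> 0"
  obtains u where "f u \<noteq> 0" "comb x u \<noteq> 0"
proof -
  obtain s where s: "s \<in> {1, -1}" "has_sign s (e j)"
    using domain_has_sign[of j] j by (metis less_imp_le)
  obtain u where u: "u \<in> e j" "0 < s * f u"
    using has_sign_strict[OF s(2,1)] by blast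
  then have "comb x u = x j * f u"
    using comb_eq_coef[OF s(1) u(2)] coef_on_domain[of j s u x] j s by simp
  then show ?thesis
    using that[of u] u x by (cases "f u = 0") auto
qed

text \<open>
  One step of gradient descent for the energy, restricted to the zeros of \<open>f\<close>. There the combination
  vanishes, so the step cannot reduce the mass.
\<close>

definition relaxed_comb :: "real \<Rightarrow> (nat \<Rightarrow> real) \<Rightarrow> 'v \<Rightarrow> real" where
  "relaxed_comb t x u = comb x u - (if f u = 0 then t * p_laplacian w p (comb x) u else 0)"

text \<open>
  The gradient at the new point paired with the step direction. Using the new point makes the bound
  on the energy an instance of the tangent inequality, for every \<open>t\<close>.
\<close>

definition descent_rate :: "real \<Rightarrow> (nat \<Rightarrow> real) \<Rightarrow> real" where
  "descent_rate t x = p * (\<Sum>u | f u = 0. p_laplacian w p (comb x) u * p_laplacian w p (relaxed_comb t x) u)"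

lemma relaxed_comb_0 [simp]: "relaxed_comb 0 x = comb x"
  by (auto simp: relaxed_comb_def)

lemma energy_relaxed_comb:
  "dirichlet_energy w p (relaxed_comb t x) + t * descent_rate t x \<le> dirichlet_energy w p (comb x)"
proof -
  have "(\<Sum>u\<in>UNIV. (comb x u - relaxed_comb t x u) * p_laplacian w p (relaxed_comb t x) u)
      = (\<Sum>u | f u = 0. t * (p_laplacian w p (comb x) u * p_laplacian w p (relaxed_comb t x) u))"
    by (intro sum.mono_neutral_cong_right) (auto simp: relaxed_comb_def)
  then have "p * (\<Sum>u\<in>UNIV. (comb x u - relaxed_comb t x u) * p_laplacian w p (relaxed_comb t x) u) = t * descent_rate t x"
    by (simp add: descent_rate_def flip: sum_distrib_left)
  then show ?thesis
    using energy_above_tangent[OF p_gt_1, of "relaxed_comb t x" "comb x"] by simp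
qed

lemma p_mass_relaxed_comb: "p_mass \<mu> p (comb x) \<le> p_mass \<mu> p (relaxed_comb t x)"
  unfolding p_mass_def
proof (rule sum_mono)
  fix u
  show "\<mu> u * \<bar>comb x u\<bar> powr p \<le> \<mu> u * \<bar>relaxed_comb t x u\<bar> powr p"
    using vertex_weight_pos[of u] by (cases "f u = 0") (auto simp: comb_eq_0 relaxed_comb_def)
qed

lemma descent_rate_pos:
  assumes eq: "dirichlet_energy w p (comb x) = lam * p_mass \<mu> p (comb x)"
    and j: "j < k" "x j \<noteq> 0"
  shows "0 < descent_rate 0 x"
proof -
  obtain z where z: "f z = 0" "p_laplacian w p (comb x) z \<noteq> 0"
    using critical_comb_imp_zero[OF eq _ j(1)] j(2) by blast
  have "0 < (\<Sum>u | f u = 0. p_laplacian w p (comb x) u * p_laplacian w p (comb x) u)"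
    by (rule sum_pos2[where i = z]) (use z in \<open>auto simp: zero_less_mult_iff\<close>)
  then show ?thesis
    using p_gt_1 by (simp add: descent_rate_def)
qed

end

section \<open>A set of large genus below the eigenvalue\<close>

text \<open>
  If no step size worked for all points, there would be bad points \<open>x n\<close> for step sizes \<open>t n\<close> tending to
  \<open>0\<close>; at a limit point \<open>a\<close> would vanish, so \<open>h\<close> would be positive near it, which contradicts badness.
\<close>

lemma compact_uniform_descent:
  fixes S :: "'a::metric_space set" and h :: "real \<Rightarrow> 'a \<Rightarrow> real"
  assumes S: "compact S" and a: "continuous_on S a"
    and h: "continuous_on ({0..1} \<times> S) (\<lambda>z. h (fst z) (snd z))"
    and le: "\<And>x. x \<in> S \<Longrightarrow> a x \<le> 0" and pos: "\<And>x. \<lbrakk>x \<in> S; a x = 0\<rbrakk> \<Longrightarrow> 0 < h 0 x"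
  obtains t where "0 < t" "\<And>x. x \<in> S \<Longrightarrow> a x - t * h t x < 0"
proof -
  have "\<exists>t>0. \<forall>x\<in>S. a x - t * h t x < 0"
  proof (rule ccontr)
    assume *: "\<not> ?thesis"
    define t where "t n = inverse (real (Suc n))" for n
    have t: "0 < t n" "t n \<le> 1" for n
      by (simp_all add: t_def inverse_le_1_iff)
    have "\<exists>x\<in>S. 0 \<le> a x - t n * h (t n) x" for n
      using * t(1)[of n] by (meson not_le)
    then obtain x where x: "\<And>n. x n \<in> S" "\<And>n. 0 \<le> a (x n) - t n * h (t n) (x n)"
      by metis
    obtain l r where l: "l \<in> S" and r: "strict_mono (r :: nat \<Rightarrow> nat)" and lim: "(x \<circ> r) \<longlonglongrightarrow> l"
      using S x(1) unfolding compact_def by blast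
    have "t \<longlonglongrightarrow> 0"
      unfolding t_def by (rule LIMSEQ_inverse_real_of_nat)
    then have tr: "(t \<circ> r) \<longlonglongrightarrow> 0"
      using r by (rule LIMSEQ_subseq_LIMSEQ)
    have "(\<lambda>n. ((t \<circ> r) n, (x \<circ> r) n)) \<longlonglongrightarrow> (0, l)"
      using tr lim by (rule tendsto_Pair)
    then have hlim: "(\<lambda>n. h (t (r n)) (x (r n))) \<longlonglongrightarrow> h 0 l"
      using continuous_on_tendsto_compose[OF h, of "\<lambda>n. ((t \<circ> r) n, (x \<circ> r) n)" "(0, l)"] t x(1) l
      by (simp add: less_imp_le)
    have alim: "(\<lambda>n. a (x (r n))) \<longlonglongrightarrow> a l"
      using continuous_on_tendsto_compose[OF a lim l] x(1) by simp
    have "(\<lambda>n. a (x (r n)) - t (r n) * h (t (r n)) (x (r n))) \<longlonglongrightarrow> a l - 0 * h 0 l"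
      using tr by (intro tendsto_intros alim hlim) (simp add: o_def)
    then have "0 \<le> a l - 0 * h 0 l"
      by (rule LIMSEQ_le_const) (use x(2) in blast)
    then have "0 < h 0 l"
      using le[OF l] pos[OF l] by simp
    then have "\<forall>\<^sub>F n in sequentially. 0 < h (t (r n)) (x (r n))"
      using hlim by (simp add: order_tendsto_iff)
    then obtain n where n: "0 < h (t (r n)) (x (r n))"
      using eventually_happens'[OF sequentially_bot] by blast
    then have "0 < t (r n) * h (t (r n)) (x (r n))"
      using t by simp
    then show False
      using x(2)[of "r n"] le[OF x(1)[of "r n"]] by linarith
  qed
  then show ?thesis
    using that by blast
qed

text \<open>
  The defining formula has the factor \<open>\<bar>x\<bar> powr (p - 2)\<close>, which is unbounded at \<open>0\<close> for \<open>p < 2\<close>; splitting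
  into positive and negative part leaves only the exponent \<open>p - 1 > 0\<close>.
\<close>

lemma continuous_on_Phi:
  assumes "1 < p" and g: "continuous_on T g"
  shows "continuous_on T (\<lambda>x. Phi p (g x))"
proof -
  have "Phi p y = max y 0 powr (p - 1) - max (- y) 0 powr (p - 1)" for y
    using Phi_pos[of y p] Phi_pos[of "- y" p] by (cases y "0 :: real" rule: linorder_cases) (auto simp: Phi_minus max_def)
  then show ?thesis
    using assms by (auto intro!: continuous_intros continuous_on_powr')
qed

lemma continuous_on_p_laplacian:
  assumes "1 < p" and "\<And>u. continuous_on T (\<lambda>z. g z u)"
  shows "continuous_on T (\<lambda>z. p_laplacian w p (g z) u)"
  unfolding p_laplacian_def by (intro continuous_intros continuous_on_Phi assms)

lemma continuous_on_dirichlet_energy: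
  assumes "1 < p" and "\<And>u. continuous_on T (\<lambda>z. g z u)"
  shows "continuous_on T (\<lambda>z. dirichlet_energy w p (g z))"
  unfolding dirichlet_energy_def using assms by (intro continuous_intros continuous_on_powr') auto

lemma continuous_on_p_mass:
  assumes "1 < p" and "\<And>u. continuous_on T (\<lambda>z. g z u)"
  shows "continuous_on T (\<lambda>z. p_mass \<mu> p (g z))"
  unfolding p_mass_def using assms by (intro continuous_intros continuous_on_powr') auto

lemma p_mass_scale: "0 < c \<Longrightarrow> p_mass \<mu> p (\<lambda>u. g u / c) = p_mass \<mu> p g / c powr p"
  by (simp add: p_mass_def powr_divide sum_divide_distrib)

lemma dirichlet_energy_scale:
  assumes "0 < c"
  shows "dirichlet_energy w p (\<lambda>u. g u / c) = dirichlet_energy w p g / c powr p"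
proof -
  have "w u v * \<bar>g u / c - g v / c\<bar> powr p = w u v * \<bar>g u - g v\<bar> powr p / c powr p" for u v
    using assms by (simp add: powr_divide flip: diff_divide_distrib)
  then show ?thesis
    by (simp add: dirichlet_energy_def flip: sum_divide_distrib)
qed

lemma rayleigh_scale: "0 < c \<Longrightarrow> rayleigh \<mu> w p (\<lambda>u. g u / c) = rayleigh \<mu> w p g"
  by (simp add: rayleigh_eq_energy_div_mass p_mass_scale dirichlet_energy_scale)

lemma p_mass_uminus: "p_mass \<mu> p (\<lambda>u. - g u) = p_mass \<mu> p g"
  by (simp add: p_mass_def)

lemma p_laplacian_uminus: "p_laplacian w p (\<lambda>u. - g u) u = - p_laplacian w p g u"
proof -
  have "Phi p (- g u - - g v) = - Phi p (g u - g v)" for v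
    using Phi_minus[of p "g u - g v"] by simp
  then show ?thesis
    by (simp add: p_laplacian_def sum_negf)
qed

context weighted_graph
begin

text \<open>
  Needed because a supremum of reals is meaningful for bounded sets only.
\<close>

lemma rayleigh_bounded_on_p_sphere:
  assumes "1 < p"
  obtains C where "\<And>g. g \<in> p_sphere \<mu> p \<Longrightarrow> rayleigh \<mu> w p g \<le> C"
proof -
  define B where "B u = (1 / \<mu> u) powr (1 / p)" for u
  have B: "\<bar>g u\<bar> \<le> B u" if g: "g \<in> p_sphere \<mu> p" for g u
  proof -
    have "\<mu> u * \<bar>g u\<bar> powr p \<le> (\<Sum>u\<in>UNIV. \<mu> u * \<bar>g u\<bar> powr p)"
      by (rule member_le_sum) (auto intro!: mult_nonneg_nonneg less_imp_le[OF vertex_weight_pos])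
    then have "\<bar>g u\<bar> powr p \<le> 1 / \<mu> u"
      using g vertex_weight_pos[of u] by (simp add: p_sphere_def field_simps)
    then have "(\<bar>g u\<bar> powr p) powr (1 / p) \<le> B u"
      unfolding B_def using assms by (intro powr_mono2) auto
    then show ?thesis
      using assms by (simp add: powr_powr)
  qed
  show ?thesis
  proof
    fix g
    assume g: "g \<in> p_sphere \<mu> p"
    have "\<bar>g u - g v\<bar> \<le> B u + B v" for u v
      using B[OF g, of u] B[OF g, of v] by linarith
    then have "dirichlet_energy w p g \<le> 1 / 2 * (\<Sum>u\<in>UNIV. \<Sum>v\<in>UNIV. w u v * (B u + B v) powr p)"
      unfolding dirichlet_energy_def using assms
      by (intro mult_left_mono sum_mono powr_mono2 edge_weight_nonneg) auto
    moreover have "p_mass \<mu> p g = 1"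
      using g by (simp add: p_sphere_def p_mass_def)
    ultimately show "rayleigh \<mu> w p g \<le> 1 / 2 * (\<Sum>u\<in>UNIV. \<Sum>v\<in>UNIV. w u v * (B u + B v) powr p)"
      by (simp add: rayleigh_eq_energy_div_mass)
  qed
qed

text \<open>
  The infimum is over values that are bounded below by \<open>0\<close>: every member of the family is nonempty, as its
  genus is positive.
\<close>

lemma variational_eigenvalue_le:
  assumes "1 < p" "1 \<le> k" and A: "A \<in> genus_family \<mu> p k"
  shows "variational_eigenvalue \<mu> w p k \<le> (SUP g\<in>A. rayleigh \<mu> w p g)"
  unfolding variational_eigenvalue_def
proof (rule cINF_lower[OF _ A], rule bdd_belowI2)
  fix B
  assume B: "B \<in> genus_family \<mu> p k"
  have "B \<noteq> {}"
    using B \<open>1 \<le> k\<close> by (auto simp: genus_family_def genus_def zero_enat_def)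
  then obtain g where g: "g \<in> B"
    by blast
  obtain C where "\<And>g. g \<in> p_sphere \<mu> p \<Longrightarrow> rayleigh \<mu> w p g \<le> C"
    using rayleigh_bounded_on_p_sphere[OF \<open>1 < p\<close>] by blast
  then have "bdd_above (rayleigh \<mu> w p ` B)"
    using B by (intro bdd_aboveI2[of _ _ C]) (auto simp: genus_family_def)
  then have "rayleigh \<mu> w p g \<le> (SUP g\<in>B. rayleigh \<mu> w p g)"
    using g by (rule cSUP_upper[rotated])
  moreover have "0 \<le> rayleigh \<mu> w p g"
    by (simp add: rayleigh_eq_energy_div_mass energy_nonneg p_mass_nonneg)
  ultimately show "0 \<le> (SUP g\<in>B. rayleigh \<mu> w p g)"
    by linarith
qed

end

text \<open>
  An odd map from the image to \<open>j\<close> dimensions without the origin pulls back to the sphere, so the Borsuk-Ulam theorem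
  gives \<open>m < j\<close>.
\<close>

lemma genus_of_odd_sphere_image:
  assumes cont: "continuous_on (topspace (nsphere m)) \<psi>"
    and odd: "\<And>x. x \<in> topspace (nsphere m) \<Longrightarrow> \<psi> (\<lambda>i. - x i) = (\<lambda>u. - \<psi> x u)"
  shows "enat (Suc m) \<le> genus (\<psi> ` topspace (nsphere m))"
proof -
  define A where "A = \<psi> ` topspace (nsphere m)"
  have "A \<noteq> {}"
    using in_topspace_nsphere[of m] by (auto simp: A_def)
  have "enat (Suc m) \<le> enat j"
    if h: "continuous_map (top_of_set A) (Euclidean_space j) h" "\<forall>g\<in>A. h g \<noteq> (\<lambda>i. 0)"
      "\<forall>g\<in>A. h (\<lambda>u. - g u) = (\<lambda>i. - h g i)" for j h
  proof -
    have "continuous_map (nsphere m) (top_of_set A) \<psi>"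
    proof -
      have "continuous_map (top_of_set (topspace (nsphere m))) (top_of_set A) \<psi>"
        using cont by (simp add: continuous_map_in_subtopology A_def)
      then show ?thesis
        by (simp flip: nsphere_top_of_set)
    qed
    then have "continuous_map (nsphere m) (Euclidean_space j) (h \<circ> \<psi>)"
      using h(1) by (rule continuous_map_compose)
    then have "m < j"
      by (rule Borsuk_Ulam) (use odd h(2,3) in \<open>auto simp: A_def\<close>)
    then show ?thesis
      by simp
  qed
  then have "enat (Suc m) \<le> genus A"
    unfolding genus_def using \<open>A \<noteq> {}\<close> by (auto intro!: Inf_greatest)
  then show ?thesis
    by (simp add: A_def)
qed

context eigenfunction_with_nodal_domains
begin

lemma comb_uminus: "comb (\<lambda>i. - x i) = (\<lambda>u. - comb x u)"
  by (simp add: comb_def sum_negf fun_eq_iff)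

lemma relaxed_comb_uminus: "relaxed_comb t (\<lambda>i. - x i) = (\<lambda>u. - relaxed_comb t x u)"
  by (simp add: relaxed_comb_def comb_uminus p_laplacian_uminus fun_eq_iff)

lemma continuous_on_comb:
  assumes "\<And>i. continuous_on T (\<lambda>z. x z i)"
  shows "continuous_on T (\<lambda>z. comb (x z) u)"
  unfolding comb_def by (intro continuous_intros assms)

lemma continuous_on_relaxed_comb:
  assumes t: "continuous_on T t" and x: "\<And>i. continuous_on T (\<lambda>z. x z i)"
  shows "continuous_on T (\<lambda>z. relaxed_comb (t z) (x z) u)"
  unfolding relaxed_comb_def
  by (cases "f u = 0") (auto intro!: continuous_intros t continuous_on_p_laplacian[OF p_gt_1] continuous_on_comb x)

text \<open>
  The compactness lemma applied to the excess of the energy over \<open>lam\<close> times the mass. Where the excess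
  is \<open>0\<close>, rigidity makes the descent rate positive.
\<close>

lemma relaxed_energy_below:
  assumes S: "compact S" and nz: "\<And>x. x \<in> S \<Longrightarrow> \<exists>j<k. x j \<noteq> 0"
  obtains t where "\<And>x. x \<in> S \<Longrightarrow> dirichlet_energy w p (relaxed_comb t x) < lam * p_mass \<mu> p (relaxed_comb t x)"
proof -
  define a where "a x = dirichlet_energy w p (comb x) - lam * p_mass \<mu> p (comb x)" for x
  have coord: "continuous_on T (\<lambda>x. x i)" for T and i :: nat
    by (rule continuous_on_subset[OF continuous_on_product_coordinates]) simp
  have coord': "continuous_on T (\<lambda>z. snd z i)" for T :: "(real \<times> (nat \<Rightarrow> real)) set" and i
    by (rule continuous_on_compose2[OF coord[of UNIV]]) (auto intro: continuous_intros)
  obtain t where t: "0 < t" "\<And>x. x \<in> S \<Longrightarrow> a x - t * descent_rate t x < 0"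
  proof (rule compact_uniform_descent[OF S])
    show "continuous_on S a"
      unfolding a_def
      by (intro continuous_intros continuous_on_dirichlet_energy continuous_on_p_mass p_gt_1 continuous_on_comb coord)
    show "continuous_on ({0..1} \<times> S) (\<lambda>z. descent_rate (fst z) (snd z))"
      unfolding descent_rate_def
      by (intro continuous_intros continuous_on_p_laplacian p_gt_1 continuous_on_comb continuous_on_relaxed_comb coord')
    show "a x \<le> 0" for x
      using energy_comb_le[of x] by (simp add: a_def)
    show "0 < descent_rate 0 x" if "x \<in> S" "a x = 0" for x
      using descent_rate_pos[of x] nz[OF that(1)] that(2) by (auto simp: a_def)
  qed blast
  show ?thesis
  proof
    fix x
    assume "x \<in> S"
    have "lam * p_mass \<mu> p (comb x) \<le> lam * p_mass \<mu> p (relaxed_comb t x)"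
      using p_mass_relaxed_comb eigenvalue_nonneg by (intro mult_left_mono)
    then show "dirichlet_energy w p (relaxed_comb t x) < lam * p_mass \<mu> p (relaxed_comb t x)"
      using t(2)[OF \<open>x \<in> S\<close>] energy_relaxed_comb[of t x] by (simp add: a_def)
  qed
qed

text \<open>
  The relaxed combinations over the coefficient sphere, scaled to mass \<open>1\<close>, form a competitor in the
  definition of the \<open>k\<close>-th variational eigenvalue. They do not vanish, since the relaxation leaves
  the nonzero vertices of \<open>f\<close> alone.
\<close>

lemma variational_eigenvalue_less:
  assumes k: "1 \<le> k"
  shows "variational_eigenvalue \<mu> w p k < lam"
proof -
  obtain m where m: "k = Suc m"
    using k by (cases k) auto
  define S where "S = topspace (nsphere m)"
  have S: "compact S" "S \<noteq> {}"
    using compact_nsphere in_topspace_nsphere by (auto simp: S_def)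
  have nz: "\<exists>j<k. x j \<noteq> 0" if "x \<in> S" for x
  proof -
    obtain j where "j \<le> m" "1 / real (m + 1) \<le> \<bar>x j\<bar>"
      using nsphere_large_coordinate \<open>x \<in> S\<close> unfolding S_def by blast
    moreover have "0 < 1 / real (m + 1)"
      by simp
    ultimately show ?thesis
      by (intro exI[of _ j]) (auto simp: m)
  qed
  obtain t where t: "\<And>x. x \<in> S \<Longrightarrow> dirichlet_energy w p (relaxed_comb t x) < lam * p_mass \<mu> p (relaxed_comb t x)"
    using relaxed_energy_below[OF S(1) nz] by blast
  define M where "M x = p_mass \<mu> p (relaxed_comb t x)" for x
  define \<psi> where "\<psi> x u = relaxed_comb t x u / M x powr (1 / p)" for x u
  have M: "0 < M x" if "x \<in> S" for x
  proof -
    obtain j where j: "j < k" "x j \<noteq> 0"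
      using nz[OF \<open>x \<in> S\<close>] by blast
    obtain u where "comb x u \<noteq> 0" "f u \<noteq> 0"
      using comb_nonzero[of j x, OF j] by blast
    then have "relaxed_comb t x u \<noteq> 0"
      by (simp add: relaxed_comb_def)
    then show ?thesis
      unfolding M_def by (rule p_mass_pos)
  qed
  have M_ne: "M x \<noteq> 0" if "x \<in> S" for x
    using M[OF that] by simp
  have ray: "rayleigh \<mu> w p (\<psi> x) = rayleigh \<mu> w p (relaxed_comb t x)" if "x \<in> S" for x
    unfolding \<psi>_def using M[OF that] by (intro rayleigh_scale) simp
  have ray_less: "rayleigh \<mu> w p (\<psi> x) < lam" if "x \<in> S" for x
    using t[OF that] M[OF that] unfolding ray[OF that] unfolding rayleigh_eq_energy_div_mass
    by (simp add: M_def divide_less_eq)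
  have cont_rel: "continuous_on S (\<lambda>x. relaxed_comb t x u)" for u
    by (intro continuous_on_relaxed_comb continuous_intros continuous_on_subset[OF continuous_on_product_coordinates]) simp
  have contM: "continuous_on S M"
    unfolding M_def by (intro continuous_on_p_mass p_gt_1 cont_rel)
  have cont: "continuous_on S \<psi>"
  proof (rule continuous_on_coordinatewise_then_product)
    fix u
    show "continuous_on S (\<lambda>x. \<psi> x u)"
      unfolding \<psi>_def by (intro continuous_intros cont_rel contM) (simp_all add: M_ne)
  qed
  have odd: "\<psi> (\<lambda>i. - x i) = (\<lambda>u. - \<psi> x u)" for x
    by (simp add: \<psi>_def M_def relaxed_comb_uminus p_mass_uminus fun_eq_iff)
  have Sneg: "(\<lambda>i. - x i) \<in> S" if "x \<in> S" for x
    using that by (simp add: S_def nsphere_uminus)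
  have "\<psi> ` S \<in> genus_family \<mu> p k"
    unfolding genus_family_def
  proof (intro CollectI conjI)
    show "\<psi> ` S \<subseteq> p_sphere \<mu> p"
    proof (rule image_subsetI)
      fix x
      assume x: "x \<in> S"
      have "p_mass \<mu> p (\<psi> x) = M x / (M x powr (1 / p)) powr p"
        unfolding \<psi>_def using M[OF x] by (subst p_mass_scale) (simp_all add: M_def)
      also have "\<dots> = 1"
        using M[OF x] p_gt_1 by (simp add: powr_powr)
      finally show "\<psi> x \<in> p_sphere \<mu> p"
        by (simp add: p_sphere_def p_mass_def)
    qed
    show "symmetric_set (\<psi> ` S)"
      unfolding symmetric_set_def
    proof (intro equalityI subsetI)
      fix g
      assume "g \<in> (\<lambda>g u. - g u) ` \<psi> ` S"
      then obtain x where x: "x \<in> S" "g = (\<lambda>u. - \<psi> x u)"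
        by auto
      then show "g \<in> \<psi> ` S"
        using Sneg[OF x(1)] odd[of x] by (metis imageI)
    next
      fix g
      assume "g \<in> \<psi> ` S"
      then obtain x where x: "x \<in> S" "g = \<psi> x"
        by auto
      then have "g = (\<lambda>u. - \<psi> (\<lambda>i. - x i) u)"
        by (simp add: odd)
      then show "g \<in> (\<lambda>g u. - g u) ` \<psi> ` S"
        using Sneg[OF x(1)] by blast
    qed
    show "closed (\<psi> ` S)"
      by (intro compact_imp_closed compact_continuous_image cont S)
    show "enat k \<le> genus (\<psi> ` S)"
      unfolding m S_def using cont odd by (intro genus_of_odd_sphere_image) (auto simp: S_def)
  qed
  then have "variational_eigenvalue \<mu> w p k \<le> (SUP g\<in>\<psi> ` S. rayleigh \<mu> w p g)"
    by (rule variational_eigenvalue_le[OF p_gt_1 k])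
  also have "\<dots> < lam"
  proof -
    have "continuous_on S (\<lambda>x. dirichlet_energy w p (relaxed_comb t x) / M x)"
      by (intro continuous_intros continuous_on_dirichlet_energy p_gt_1 cont_rel contM) (simp add: M_ne)
    then have "continuous_on S (\<lambda>x. rayleigh \<mu> w p (\<psi> x))"
      by (rule continuous_on_eq) (simp only: ray, simp only: rayleigh_eq_energy_div_mass M_def)
    then obtain x0 where x0: "x0 \<in> S" "\<And>x. x \<in> S \<Longrightarrow> rayleigh \<mu> w p (\<psi> x) \<le> rayleigh \<mu> w p (\<psi> x0)"
      using continuous_attains_sup[OF S] by blast
    then have "(SUP g\<in>\<psi> ` S. rayleigh \<mu> w p g) \<le> rayleigh \<mu> w p (\<psi> x0)"
      using S by (intro cSUP_least) auto
    then show ?thesis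
      using ray_less[OF x0(1)] by linarith
  qed
  finally show ?thesis .
qed

end

theorem theorem3p5:
  fixes G :: "('v::finite) pair_pre_digraph"
    and \<mu> :: "'v \<Rightarrow> real"
    and w :: "'v \<Rightarrow> 'v \<Rightarrow> real"
    and p :: real
    and k :: nat
    and f :: "'v \<Rightarrow> real"
  assumes "weighted_graph G \<mu> w"
    and "p > 1"
    and "1 \<le> k" and "k \<le> CARD('v)"
    and "eigenfunction \<mu> w p (variational_eigenvalue \<mu> w p k) f"
  shows "card {A. weak_nodal_domain G f A} \<le> k"
proof (rule ccontr)
  assume "\<not> ?thesis"
  then have "card {..k} \<le> card {A. weak_nodal_domain G f A}"
    by simp
  then obtain e where e: "e ` {..k} \<subseteq> {A. weak_nodal_domain G f A}" "inj_on e {..k}"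
    using card_le_inj[of "{..k}" "{A. weak_nodal_domain G f A}"] by auto
  interpret weighted_graph G \<mu> w
    by (rule assms(1))
  interpret eigenfunction_with_nodal_domains G \<mu> w p "variational_eigenvalue \<mu> w p k" f k e
    using assms(2,5) e by unfold_locales auto
  show False
    using variational_eigenvalue_less[OF assms(3)] by simp
qed

end
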